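(* Let $\mathcal{G}=(\mathcal{N},\mathcal{E})$, $\mathcal{Q}_\mathcal{G}=\{1,\dots,q\}$, the system matrices $A,B,B_w,C,D,D_w$, and $\mathcal{S}$, $E$, $M$, $\tilde A$, $\tilde B$, $\tilde B_w$, $\tilde C$, $\tilde D$, $\mathbb{D}$, $\mathbb{D}^{++}$ be as in the context, let $\gamma\in\mathbb{R}$, and suppose that $\mathcal{Q}_\mathcal{G}^i\neq\emptyset$ for all $i\in\mathcal{N}$ and that, for all distinct $i,j\in\mathcal{N}$, $\mathcal{Q}_\mathcal{G}^i\cap\mathcal{Q}_\mathcal{G}^j\neq\emptyset\Leftrightarrow(i,j)\in\mathcal{E}$. Let $\mathcal{K}_\mathcal{S}^{\infty,\gamma}$ be the set of all $K\in\mathcal{S}$ for which there is $P\in\mathcal{S}$, $P\succ O$, with $$\begin{bmatrix}(A+BK)^\top P+P(A+BK)&PB_w&(C+DK)^\top\\ B_w^\top P&-\gamma I&D_w^\top\\ C+DK&D_w&-\gamma I\end{bmatrix}\prec O .$$ Define $$\Gamma_\gamma(\tilde Q,\tilde Z)=\begin{bmatrix}\mathrm{He}(\tilde A\tilde Q+\tilde B\tilde Z)&\tilde B_w&\tilde Q\tilde C^\top+\tilde Z^\top\tilde D^\top\\ \tilde B_w^\top&-\gamma I&D_w^\top\\ \tilde C\tilde Q+\tilde D\tilde Z&D_w&-\gamma I\end{bmatrix},$$ $$\hat{\mathcal{K}}_\mathcal{S}^{\infty,\gamma}=\{(E^\top E)^{-1}E^\top(\tilde Z\tilde Q^{-1})E:\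 \tilde Z\in\mathbb{D},\ \tilde Q\in\mathbb{D}^{++},\ \exists\rho\in\mathbb{R}\ \text{s.t.}\ \Gamma_\gamma(\tilde Q,\tilde Z)+\mathrm{blkdiag}(\rho\tilde QM\tilde Q,O,O)\prec O\}.$$ Then $\hat{\mathcal{K}}_\mathcal{S}^{\infty,\gamma}\subset\mathcal{K}_\mathcal{S}^{\infty,\gamma}$. Moreover, $\hat{\mathcal{K}}_\mathcal{S}^{\infty,\gamma}=\mathcal{K}_\mathcal{S}^{\infty,\gamma}$ if $\mathcal{G}$ is chordal and $\mathcal{Q}_\mathcal{G}$ is the index set of all maximal cliques of $\mathcal{G}$.
   Context: $\mathcal{G}=(\mathcal{N},\mathcal{E})$ is an undirected graph with $\mathcal{N}=\{1,\dots,N\}$; $\mathcal{E}$ is a set of pairs $(i,j)$ of distinct nodes with $(i,j)\in\mathcal{E}\Leftrightarrow(j,i)\in\mathcal{E}$. A clique is a nonempty $\mathcal{C}\subset\mathcal{N}$ with $(i,j)\in\mathcal{E}$ for all distinct $i,j\in\mathcal{C}$; it is maximal if not contained in another clique. $\mathcal{G}$ is chordal if every cycle of length at least four has a chord. $\mathcal{Q}_\mathcal{G}=\{1,\dots,q\}$ indexes a collection of distinct cliques $\mathcal{C}_1,\dots,\mathcal{C}_q$ of $\mathcal{G}$ (not necessarily all, not necessarily maximal), and $\mathcal{Q}_\mathcal{G}^i=\{k\in\mathcal{Q}_\mathcal{G}: i\in\mathcal{C}_k\}$. Let $n=\sum_{i=1}^N n_i$ with positive integers $n_i$; $n\times n$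 matrices are partitioned into blocks $K_{ij}\in\mathbb{R}^{n_i\times n_j}$ (state and input dimensions of each subsystem are taken equal). Define $\mathcal{S}=\{K\in\mathbb{R}^{n\times n}:K_{ij}=O\text{ if }(i,j)\notin\mathcal{E},\ i\neq j\}$. The system is $\dot x=Ax+Bu+B_ww$, $y=Cx+Du+D_ww$ with $u=Kx$, where $A,B\in\mathbb{R}^{n\times n}$, $B_w\in\mathbb{R}^{n\times n_w}$, $C,D\in\mathbb{R}^{n_y\times n}$, $D_w\in\mathbb{R}^{n_y\times n_w}$ (by the bounded real lemma, the matrix inequality with some $P\succ O$ is equivalent to $A+BK$ being Hurwitz with closed-loop $H_\infty$ norm from $w$ to $y$ less than $\gamma$). $E_j=[O_{n_j\times n_1},\dots,I_{n_j},\dots,O_{n_j\times n_N}]\in\mathbb{R}^{n_j\times n}$ (identity in the $j$th block). $n_{\mathcal{C}_k}=\sum_{j\in\mathcal{C}_k}n_j$; $E_{\mathcal{C}_k}\in\mathbb{R}^{n_{\mathcal{C}_k}\times n}$ is obtained by stacking the $E_j$, $j\in\mathcal{C}_k$, vertically (in increasing order of $j$); $E=[E_{\mathcal{C}_1}^\top,\dots,E_{\mathcal{C}_q}^\top]^\top$. When all $\mathcal{Q}_\mathcal{G}^i\ne\emptyset$, $E^\top E$ is invertible (block diagonal with blocks $|\mathcal{Q}_\mathcal{G}^i|I_{n_i}$). $M=I-E(E^\top E)^{-1}E^\top$, $\tilde A=EA(E^\top E)^{-1}E^\top$, $\tilde B=EB(E^\top E)^{-1}E^\top$, $\tilde B_w=EB_w$,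 $\tilde C=C(E^\top E)^{-1}E^\top$, $\tilde D=D(E^\top E)^{-1}E^\top$. $\mathbb{D}=\{\mathrm{blkdiag}(\tilde P_1,\dots,\tilde P_q):\tilde P_k\in\mathbb{R}^{n_{\mathcal{C}_k}\times n_{\mathcal{C}_k}}\}$, and $\mathbb{D}^{++}$ is the subset of those with every $\tilde P_k\succ O$. $\mathrm{He}(X)=X+X^\top$. $X\succ O$ ($X\prec O$) means symmetric positive (negative) definite. $O$ and $I$ denote zero and identity matrices of conformable size. *)

theory Defs
  imports
    "Jordan_Normal_Form.Gauss_Jordan_Elimination"
    "Graph_Theory.Pair_Digraph"
    Complex_Main
begin

definition clique :: "nat pair_pre_digraph \<Rightarrow> nat set \<Rightarrow> bool" where
  "clique G S \<longleftrightarrow> S \<noteq> {} \<and> S \<subseteq> pverts G \<and> (\<forall>i\<in>S. \<forall>j\<in>S. i \<noteq> j \<longrightarrow> (i, j) \<in> parcs G)"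

definition maximal_clique :: "nat pair_pre_digraph \<Rightarrow> nat set \<Rightarrow> bool" where
  "maximal_clique G S \<longleftrightarrow> clique G S \<and> \<not> (\<exists>T. clique G T \<and> S \<subset> T)"

text \<open>A library cycle \<open>p\<close> is a list of arcs; on \<open>fst ` set p\<close>, its set of vertices, a chord
  is an edge that occurs in \<open>p\<close> in neither of its two orientations. The library cycles of length
  at least three are exactly the cycles of the undirected graph.\<close>

definition chordal :: "nat pair_pre_digraph \<Rightarrow> bool" where
  "chordal G \<longleftrightarrow> (\<forall>p. pre_digraph.cycle (with_proj G) p \<and> 4 \<le> length p \<longrightarrow>
     (\<exists>u \<in> fst ` set p. \<exists>v \<in> fst ` set p.
        (u, v) \<in> parcs G \<and> (u, v) \<notin> set p \<and> (v, u) \<notin> set p))"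

text \<open>The cliques are \<open>Cl 1, \<dots>, Cl q\<close>; the values of \<open>Cl\<close> elsewhere are irrelevant.\<close>

definition clique_idx :: "nat \<Rightarrow> (nat \<Rightarrow> nat set) \<Rightarrow> nat \<Rightarrow> nat set" where
  "clique_idx q Cl i = {k \<in> {1..q}. i \<in> Cl k}"

text \<open>The inverse of an invertible square matrix (unspecified otherwise).\<close>

definition inv_mat :: "real mat \<Rightarrow> real mat" where
  "inv_mat X = the (mat_inverse X)"

lemma inv_mat_eqI:
  assumes X: "X \<in> carrier_mat n n" and Y: "Y \<in> carrier_mat n n"
    and XY: "X * Y = 1\<^sub>m n" and YX: "Y * X = 1\<^sub>m n"
  shows "inv_mat X = Y"
proof (cases "mat_inverse X")
  case None
  have "X \<in> Units (ring_mat TYPE(real) n ())"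
    using assms by (auto simp: Units_def ring_mat_def)
  with mat_inverse(1)[OF X None, of "()"] show ?thesis by blast
next
  case (Some Z)
  from mat_inverse(2)[OF X Some] have Z: "Z \<in> carrier_mat n n" and XZ: "X * Z = 1\<^sub>m n" by auto
  have "Y = Y * (X * Z)" using XZ Y by simp
  also have "\<dots> = Y * X * Z" using assoc_mult_mat[OF Y X Z] by simp
  also have "\<dots> = Z" using YX Z by simp
  finally show ?thesis by (simp add: inv_mat_def Some)
qed

definition pos_def :: "real mat \<Rightarrow> bool" where
  "pos_def X \<longleftrightarrow> X\<^sup>T = X \<and> (\<forall>x \<in> carrier_vec (dim_row X). x \<noteq> 0\<^sub>v (dim_row X) \<longrightarrow> x \<bullet> (X *\<^sub>v x) > 0)"

definition neg_def :: "real mat \<Rightarrow> bool" where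
  "neg_def X \<longleftrightarrow> X\<^sup>T = X \<and> (\<forall>x \<in> carrier_vec (dim_row X). x \<noteq> 0\<^sub>v (dim_row X) \<longrightarrow> x \<bullet> (X *\<^sub>v x) < 0)"

definition He :: "real mat \<Rightarrow> real mat" where
  "He X = X + X\<^sup>T"

definition append_cols :: "real mat \<Rightarrow> real mat \<Rightarrow> real mat" where
  "append_cols X Y = four_block_mat X Y (0\<^sub>m 0 (dim_col X)) (0\<^sub>m 0 (dim_col Y))"

text \<open>The arguments are the nine blocks, row by row.\<close>

definition nine_block_mat ::
  "real mat \<Rightarrow> real mat \<Rightarrow> real mat \<Rightarrow> real mat \<Rightarrow> real mat \<Rightarrow> real mat \<Rightarrow>
   real mat \<Rightarrow> real mat \<Rightarrow> real mat \<Rightarrow> real mat" where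
  "nine_block_mat X11 X12 X13 X21 X22 X23 X31 X32 X33 =
     four_block_mat (four_block_mat X11 X12 X21 X22) (X13 @\<^sub>r X23) (append_cols X31 X32) X33"

text \<open>Nodes are \<open>1, \<dots>, N\<close>, and node \<open>i\<close> has the state (and input) dimension \<open>ns i\<close>. Matrix
  entries are indexed from \<open>0\<close>, so block \<open>i\<close> occupies the positions
  \<open>offset ns i, \<dots>, offset ns i + ns i - 1\<close>.\<close>

definition total_dim :: "nat \<Rightarrow> (nat \<Rightarrow> nat) \<Rightarrow> nat" where
  "total_dim N ns = (\<Sum>i = 1..N. ns i)"

definition offset :: "(nat \<Rightarrow> nat) \<Rightarrow> nat \<Rightarrow> nat" where
  "offset ns i = (\<Sum>j \<in> {1..<i}. ns j)"

definition blk :: "(nat \<Rightarrow> nat) \<Rightarrow> real mat \<Rightarrow> nat \<Rightarrow> nat \<Rightarrow> real mat" where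
  "blk ns K i j = mat (ns i) (ns j) (\<lambda>(a, b). K $$ (offset ns i + a, offset ns j + b))"

definition sparse_mats :: "nat \<Rightarrow> (nat \<Rightarrow> nat) \<Rightarrow> nat pair_pre_digraph \<Rightarrow> real mat set" where
  "sparse_mats N ns G = {K \<in> carrier_mat (total_dim N ns) (total_dim N ns).
     \<forall>i \<in> {1..N}. \<forall>j \<in> {1..N}. (i, j) \<notin> parcs G \<and> i \<noteq> j \<longrightarrow> blk ns K i j = 0\<^sub>m (ns i) (ns j)}"

definition E_node :: "nat \<Rightarrow> (nat \<Rightarrow> nat) \<Rightarrow> nat \<Rightarrow> real mat" where
  "E_node N ns j = mat (ns j) (total_dim N ns) (\<lambda>(a, b). if b = offset ns j + a then 1 else 0)"

definition stack_rows :: "nat \<Rightarrow> real mat list \<Rightarrow> real mat" where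
  "stack_rows nc Xs = foldr (@\<^sub>r) Xs (0\<^sub>m 0 nc)"

definition E_clique :: "nat \<Rightarrow> (nat \<Rightarrow> nat) \<Rightarrow> nat set \<Rightarrow> real mat" where
  "E_clique N ns S = stack_rows (total_dim N ns) (map (E_node N ns) (sorted_list_of_set S))"

definition E_mat :: "nat \<Rightarrow> (nat \<Rightarrow> nat) \<Rightarrow> nat \<Rightarrow> (nat \<Rightarrow> nat set) \<Rightarrow> real mat" where
  "E_mat N ns q Cl = stack_rows (total_dim N ns) (map (\<lambda>k. E_clique N ns (Cl k)) [1..<Suc q])"

definition left_inv :: "real mat \<Rightarrow> real mat" where
  "left_inv E = inv_mat (E\<^sup>T * E) * E\<^sup>T"

definition M_mat :: "real mat \<Rightarrow> real mat" where
  "M_mat E = 1\<^sub>m (dim_row E) - E * left_inv E"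

definition clique_dim :: "(nat \<Rightarrow> nat) \<Rightarrow> nat set \<Rightarrow> nat" where
  "clique_dim ns S = (\<Sum>j \<in> S. ns j)"

definition blkdiags :: "(nat \<Rightarrow> nat) \<Rightarrow> nat \<Rightarrow> (nat \<Rightarrow> nat set) \<Rightarrow> real mat set" where
  "blkdiags ns q Cl = {diag_block_mat (map P [1..<Suc q]) | P.
     \<forall>k \<in> {1..q}. P k \<in> carrier_mat (clique_dim ns (Cl k)) (clique_dim ns (Cl k))}"

definition blkdiags_pd :: "(nat \<Rightarrow> nat) \<Rightarrow> nat \<Rightarrow> (nat \<Rightarrow> nat set) \<Rightarrow> real mat set" where
  "blkdiags_pd ns q Cl = {diag_block_mat (map P [1..<Suc q]) | P.
     \<forall>k \<in> {1..q}. P k \<in> carrier_mat (clique_dim ns (Cl k)) (clique_dim ns (Cl k)) \<and> pos_def (P k)}"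

definition brl_mat ::
  "real mat \<Rightarrow> real mat \<Rightarrow> real mat \<Rightarrow> real mat \<Rightarrow> real mat \<Rightarrow> real mat \<Rightarrow> real \<Rightarrow>
   real mat \<Rightarrow> real mat \<Rightarrow> real mat" where
  "brl_mat A B Bw C D Dw \<gamma> K P = nine_block_mat
     ((A + B * K)\<^sup>T * P + P * (A + B * K)) (P * Bw) ((C + D * K)\<^sup>T)
     (Bw\<^sup>T * P) ((- \<gamma>) \<cdot>\<^sub>m 1\<^sub>m (dim_col Bw)) (Dw\<^sup>T)
     (C + D * K) Dw ((- \<gamma>) \<cdot>\<^sub>m 1\<^sub>m (dim_row C))"

definition K_set ::
  "nat \<Rightarrow> (nat \<Rightarrow> nat) \<Rightarrow> nat pair_pre_digraph \<Rightarrow>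
   real mat \<Rightarrow> real mat \<Rightarrow> real mat \<Rightarrow> real mat \<Rightarrow> real mat \<Rightarrow> real mat \<Rightarrow> real \<Rightarrow> real mat set" where
  "K_set N ns G A B Bw C D Dw \<gamma> = {K \<in> sparse_mats N ns G.
     \<exists>P \<in> sparse_mats N ns G. pos_def P \<and> neg_def (brl_mat A B Bw C D Dw \<gamma> K P)}"

text \<open>The first six arguments are the system matrices themselves, from which the lifted ones
  are formed with the help of \<open>E\<close>.\<close>

definition Gamma_mat ::
  "real mat \<Rightarrow> real mat \<Rightarrow> real mat \<Rightarrow> real mat \<Rightarrow> real mat \<Rightarrow> real mat \<Rightarrow> real \<Rightarrow>
   real mat \<Rightarrow> real mat \<Rightarrow> real mat \<Rightarrow> real mat" where
  "Gamma_mat A B Bw C D Dw \<gamma> E Q Z =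
    (let At = E * A * left_inv E; Bt = E * B * left_inv E; Bwt = E * Bw;
         Ct = C * left_inv E; Dt = D * left_inv E
     in nine_block_mat
       (He (At * Q + Bt * Z)) Bwt (Q * Ct\<^sup>T + Z\<^sup>T * Dt\<^sup>T)
       (Bwt\<^sup>T) ((- \<gamma>) \<cdot>\<^sub>m 1\<^sub>m (dim_col Bw)) (Dw\<^sup>T)
       (Ct * Q + Dt * Z) Dw ((- \<gamma>) \<cdot>\<^sub>m 1\<^sub>m (dim_row C)))"

definition K_hat ::
  "nat \<Rightarrow> (nat \<Rightarrow> nat) \<Rightarrow> nat \<Rightarrow> (nat \<Rightarrow> nat set) \<Rightarrow>
   real mat \<Rightarrow> real mat \<Rightarrow> real mat \<Rightarrow> real mat \<Rightarrow> real mat \<Rightarrow> real mat \<Rightarrow> real \<Rightarrow> real mat set" where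
  "K_hat N ns q Cl A B Bw C D Dw \<gamma> =
    (let E = E_mat N ns q Cl
     in {left_inv E * (Z * inv_mat Q) * E | Z Q.
          Z \<in> blkdiags ns q Cl \<and> Q \<in> blkdiags_pd ns q Cl \<and>
          (\<exists>\<rho>. neg_def (Gamma_mat A B Bw C D Dw \<gamma> E Q Z +
             diag_block_mat [\<rho> \<cdot>\<^sub>m (Q * M_mat E * Q),
               0\<^sub>m (dim_col Bw) (dim_col Bw), 0\<^sub>m (dim_row C) (dim_row C)]))})"

end

theory Submission
  imports Defs "Jordan_Normal_Form.Determinant"
begin

text \<open>Put \<open>P = Q\<^sup>-\<^sup>1\<close> and \<open>K = Z Q\<^sup>-\<^sup>1\<close>, both block diagonal, and let \<open>L\<close> be the left inverse of \<open>E\<close>.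
  The lifted inequality is congruent by \<open>diag(Q, I, I)\<close> to an inequality \<open>\<Omega> + \<rho> diag(M, 0, 0) \<prec> 0\<close>, and
  the congruence by \<open>diag(E, I, I)\<close>, which kills \<open>M\<close>, turns that one into the bounded real inequality for
  \<open>L K E\<close> and \<open>E\<^sup>T P E\<close>. As \<open>M\<close> is the orthogonal projection with kernel the range of \<open>E\<close>, Finsler's
  lemma provides the converse: the lifted inequality holds for some \<open>\<rho>\<close> if and only if the original one does.
  Every \<open>L K E\<close> and \<open>E\<^sup>T P E\<close> has the sparsity of the graph. Conversely, every sparse gain is some
  \<open>L K E\<close>, and for a chordal graph and its maximal cliques every sparse positive definite matrix is some
  \<open>E\<^sup>T P E\<close> with positive definite blocks: subtract a small multiple of \<open>E\<^sup>T E\<close> and eliminate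
  the rest along a perfect elimination ordering into rank-one terms, each supported in a clique.\<close>

subsection \<open>Simplicial vertices of chordal graphs\<close>

text \<open>The congruence by \<open>diag(E, I, I)\<close> is injective but not invertible: it only
  compresses the lifted inequality to the range of \<open>E\<close>, and the term with \<rho> has to
  control the orthogonal complement. For this Finsler's lemma needs bounds that are uniform on the
  sphere, while \<open>neg_def\<close> is pointwise; they come algebraically, from entrywise
  estimates and an inverse, without compactness. Chordality enters only through simplicial vertices.
  Their existence is proved in a stronger form, outside the closed neighbourhood of any vertex that
  has a non-neighbour, because the induction must steer away from a separator. Elimination acts on
  scalar positions instead of blocks: positions of one node count as adjacent, pivots are numbers,
  and a zero pivot simply has a zero row. Maximality enters because the closed neighbourhood of a
  pivot among the remaining nodes is some clique, which must fit into a listed one. Gains and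
  \<open>P\<close> are lifted differently: sharing each entry among the cliques that see it is
  enough for a gain, but would not keep the blocks of \<open>P\<close> definite.\<close>

definition simplicial :: "('a \<times> 'a) set \<Rightarrow> 'a set \<Rightarrow> 'a \<Rightarrow> bool" where
  "simplicial r R y \<longleftrightarrow> (\<forall>a\<in>R. \<forall>b\<in>R. (y, a) \<in> r \<longrightarrow> (y, b) \<in> r \<longrightarrow> a \<noteq> b \<longrightarrow> (a, b) \<in> r)"

text \<open>Relational powers deliver a path as a function on indices; this turns such a path,
  closed up by one arc to \<open>x\<close>, into a walk of the library.\<close>

lemma pcas_map_upt:
  "pre_digraph.cas (with_proj G) (f 0) (map (\<lambda>i. (f i, f (Suc i))) [0..<n] @ [(f n, x)]) x"
proof -
  \<comment> \<open>The starting index is generalised, since the induction strips arcs from the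
    front.\<close>
  have "pre_digraph.cas (with_proj G) (f i) (map (\<lambda>i. (f i, f (Suc i))) [i..<i + m] @ [(f (i + m), x)]) x" for i m
  proof (induction m arbitrary: i)
    case 0
    then show ?case by (simp add: pre_digraph.cas.simps del: cas_with_proj_eq)
  next
    case (Suc m)
    have "[i..<i + Suc m] = i # [Suc i..<Suc i + m]"
      by (simp add: upt_conv_Cons)
    with Suc[of "Suc i"] show ?case
      by (simp add: pre_digraph.cas.simps del: cas_with_proj_eq upt_Suc)
  qed
  from this[of 0 n] show ?thesis by simp
qed

text \<open>A shortest path from \<open>u\<close> to \<open>v\<close> through \<open>C\<close> is induced, so together with \<open>x\<close> it would be a
  chordless cycle unless \<open>u\<close> and \<open>v\<close> are adjacent.\<close>

lemma chordal_separator_adjacent: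
  assumes G: "pair_graph G" and ch: "chordal G"
    and conn: "\<And>a b. a \<in> C \<Longrightarrow> b \<in> C \<Longrightarrow> (a, b) \<in> {(a, b) \<in> parcs G. a \<in> C \<and> b \<in> C}\<^sup>*"
    and xC: "x \<notin> C" "\<And>c. c \<in> C \<Longrightarrow> (x, c) \<notin> parcs G"
    and uv: "u \<noteq> v" "u \<notin> C" "v \<notin> C" "(x, u) \<in> parcs G" "(x, v) \<in> parcs G"
    and c: "c1 \<in> C" "c2 \<in> C" "(u, c1) \<in> parcs G" "(c2, v) \<in> parcs G"
  shows "(u, v) \<in> parcs G"
proof (rule ccontr)
  assume nuv: "(u, v) \<notin> parcs G"
  interpret pair_graph G by fact
  have sym: "(b, a) \<in> parcs G" if "(a, b) \<in> parcs G" for a b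
    using that arcs_symmetric by blast
  have irr: "(a, a) \<notin> parcs G" for a using no_loops' by blast
  let ?V = "insert u (insert v C)"
  define T where "T = {(a, b) \<in> parcs G. a \<in> ?V \<and> b \<in> ?V}"
  have "(c1, c2) \<in> T\<^sup>*"
    using conn[OF c(1,2)] by (rule rtrancl_mono[THEN subsetD, rotated]) (auto simp: T_def)
  moreover have "(u, c1) \<in> T" "(c2, v) \<in> T" using c by (auto simp: T_def)
  ultimately have "(u, v) \<in> T\<^sup>*" by (meson converse_rtrancl_into_rtrancl rtrancl.rtrancl_into_rtrancl)
  then have ex: "\<exists>n. (u, v) \<in> T ^^ n" by (simp add: rtrancl_power)
  define n where "n = (LEAST n. (u, v) \<in> T ^^ n)"
  have n: "(u, v) \<in> T ^^ n" unfolding n_def using ex by (rule LeastI_ex)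
  have least: "n \<le> m" if "(u, v) \<in> T ^^ m" for m unfolding n_def using that by (rule Least_le)
  from n obtain f where f0: "f 0 = u" and fn: "f n = v" and fT: "\<And>i. i < n \<Longrightarrow> (f i, f (Suc i)) \<in> T"
    by (auto simp: relpow_fun_conv)
  have seg: "(f a, f (a + d)) \<in> T ^^ d" if "a + d \<le> n" for a d
    using that
  proof (induction d)
    case (Suc d)
    with fT[of "a + d"] show ?case by (auto intro: relpow_Suc_I)
  qed simp
  \<comment> \<open>Replacing the segment from \<open>f i\<close> to \<open>f j\<close> by
    \<open>k\<close> steps gives a path of length \<open>i + k + (n - j)\<close> from
    \<open>u\<close> to \<open>v\<close>, so minimality applies. With \<open>k = 0\<close> this
    yields injectivity, with \<open>k = 1\<close> the absence of chords.\<close>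
  have shortcut: "k \<ge> j - i" if "i \<le> j" "j \<le> n" "(f i, f j) \<in> T ^^ k" for i j k
  proof -
    have "(f 0, f i) \<in> T ^^ i" "(f j, f n) \<in> T ^^ (n - j)" using seg[of 0 i] seg[of j "n - j"] that by auto
    with that(3) have "(f 0, f n) \<in> T ^^ (i + k + (n - j))" by (auto simp: relpow_add)
    with least[of "i + k + (n - j)"] f0 fn that show ?thesis by auto
  qed
  have inj: "f i \<noteq> f j" if "i < j" "j \<le> n" for i j
    using shortcut[of i j 0] that by auto
  have injn: "inj_on f {..n}"
    by (rule inj_onI) (metis atMost_iff inj linorder_neqE_nat)
  have nochord: "(f i, f j) \<notin> T" if "Suc i < j" "j \<le> n" for i j
    using shortcut[of i j 1] that by auto
  have fV: "f i \<in> ?V" if "i \<le> n" for i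
    using that f0 fn fT[of i] by (cases "i = n") (auto simp: T_def)
  \<comment> \<open>Length 0 would mean \<open>u = v\<close> and length 1 adjacency; with the two
    arcs at \<open>x\<close> the cycle therefore has at least four arcs.\<close>
  have n2: "2 \<le> n"
  proof (rule ccontr)
    assume "\<not> 2 \<le> n"
    then have "n = 0 \<or> n = 1" by auto
    with n nuv uv show False by (auto simp: T_def)
  qed
  have inner: "f i \<in> C" if "0 < i" "i < n" for i
    using fV[of i] inj[of 0 i] inj[of i n] that f0 fn by auto
  define p where "p = (x, f 0) # map (\<lambda>i. (f i, f (Suc i))) [0..<n] @ [(f n, x)]"
  have len: "length p = n + 2" by (simp add: p_def)
  have x: "x \<in> pverts G" using uv(4) by (rule in_arcsD1)
  have arcs: "set p \<subseteq> parcs G"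
    using fT uv(4) sym[OF uv(5)] f0 fn by (auto simp: p_def T_def)
  have xf: "x \<noteq> f i" if "i \<le> n" for i
    using fV[OF that] xC(1) uv(4,5) irr by auto
  have cas: "pre_digraph.cas (with_proj G) x p x"
    unfolding p_def using pcas_map_upt[of G f n x]
    by (simp add: pre_digraph.cas.simps del: cas_with_proj_eq)
  have verts: "tl (pre_digraph.awalk_verts (with_proj G) x p) = map f [0..<Suc n] @ [x]"
    unfolding pre_digraph.awalk_verts_conv p_def by (simp add: comp_def)
  have dist: "distinct (map f [0..<Suc n] @ [x])"
    using injn xf by (auto simp: distinct_map atLeast0_lessThan_Suc_eq_insert_0 inj_on_def image_iff less_Suc_eq_le simp del: upt_Suc)
  have "pre_digraph.cycle (with_proj G) p"
    unfolding pre_digraph.cycle_def pre_digraph.awalk_def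
    using x arcs cas verts dist by (intro exI[of _ x]) (auto simp: p_def)
  moreover have "4 \<le> length p" using len n2 by simp
  ultimately obtain a b where ab: "a \<in> fst ` set p" "b \<in> fst ` set p" "(a, b) \<in> parcs G" "(a, b) \<notin> set p" "(b, a) \<notin> set p"
    using ch unfolding chordal_def by blast
  have fst_p: "fst ` set p = insert x (f ` {..n})"
  proof -
    have "fst ` set p = insert x (f ` insert n {0..<n})" by (auto simp: p_def image_image)
    also have "insert n {0..<n} = {..n}" by auto
    finally show ?thesis .
  qed
  \<comment> \<open>A chord at \<open>x\<close> would have to end at an inner vertex of the path,
    but those lie in \<open>C\<close>, where \<open>x\<close> has no neighbours.\<close>
  have x_case: False if "i \<le> n" "(x, f i) \<in> parcs G" "(x, f i) \<notin> set p" "(f i, x) \<notin> set p" for i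
  proof -
    have "i \<noteq> 0" "i \<noteq> n" using that by (auto simp: p_def intro: ccontr)
    then have "f i \<in> C" using that inner by auto
    with xC(2) that show False by auto
  qed
  have f_case: False if "i < j" "j \<le> n" "(f i, f j) \<in> parcs G" "(f i, f j) \<notin> set p" for i j
  proof -
    have "j \<noteq> Suc i" using that by (auto simp: p_def)
    moreover have "(f i, f j) \<in> T" using that fV[of i] fV[of j] by (auto simp: T_def)
    ultimately show False using nochord[of i j] that by auto
  qed
  from ab(1,2) fst_p consider "a = x" "b = x" | i where "a = x" "b = f i" "i \<le> n" | i where "a = f i" "b = x" "i \<le> n"
    | i j where "a = f i" "b = f j" "i \<le> n" "j \<le> n" by auto
  then show False
  proof cases
    case 1 then show ?thesis using ab irr by auto
  next
    case 2 then show ?thesis using ab x_case by blast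
  next
    case 3 then show ?thesis using ab x_case sym by blast
  next
    case (4 i j)
    then show ?thesis using ab f_case[of i j] f_case[of j i] sym irr by (metis linorder_neqE_nat)
  qed
qed

text \<open>Let \<open>C\<close> be the component of \<open>z\<close> outside the closed neighbourhood of \<open>x\<close>. Its outer neighbours
  \<open>S\<close> form a clique, so the induction hypothesis for \<open>C \<union> S\<close> yields a simplicial vertex in \<open>C\<close>.\<close>

lemma chordal_simplicial_avoiding:
  assumes G: "pair_graph G" and ch: "chordal G"
    and "finite R" "x \<in> R" "z \<in> R" "z \<noteq> x" "(x, z) \<notin> parcs G"
  shows "\<exists>y\<in>R. y \<noteq> x \<and> (x, y) \<notin> parcs G \<and> simplicial (parcs G) R y"
  using assms(3-)
proof (induction "card R" arbitrary: R x z rule: less_induct)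
  case less
  interpret pair_graph G by fact
  have sym: "(b, a) \<in> parcs G" if "(a, b) \<in> parcs G" for a b
    using that arcs_symmetric by blast
  define H where "H = {y \<in> R. y \<noteq> x \<and> (x, y) \<notin> parcs G}"
  define r where "r = {(a, b) \<in> parcs G. a \<in> H \<and> b \<in> H}"
  define C where "C = {y. (z, y) \<in> r\<^sup>*}"
  define rC where "rC = {(a, b) \<in> parcs G. a \<in> C \<and> b \<in> C}"
  have zH: "z \<in> H" using less.prems by (auto simp: H_def)
  have zC: "z \<in> C" by (simp add: C_def)
  have CH: "C \<subseteq> H"
  proof
    fix y assume "y \<in> C"
    then have "(z, y) \<in> r\<^sup>*" by (simp add: C_def)
    then show "y \<in> H" using zH by induction (auto simp: r_def)
  qed
  have closed: "b \<in> C" if "a \<in> C" "b \<in> H" "(a, b) \<in> parcs G" for a b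
    using that CH by (auto simp: C_def r_def intro: rtrancl_into_rtrancl)
  have conn_z: "(z, y) \<in> rC\<^sup>*" if "y \<in> C" for y
  proof -
    from that have "(z, y) \<in> r\<^sup>*" by (simp add: C_def)
    then show ?thesis
    proof induction
      case (step y w)
      then have "y \<in> C" "w \<in> C" by (auto simp: C_def)
      with step show ?case by (auto simp: r_def rC_def intro: rtrancl_into_rtrancl)
    qed simp
  qed
  have symC: "sym (rC\<^sup>*)" by (intro sym_rtrancl) (auto simp: sym_def rC_def intro: sym)
  have conn: "(a, b) \<in> rC\<^sup>*" if "a \<in> C" "b \<in> C" for a b
    using conn_z[OF that(1)] conn_z[OF that(2)] symC by (meson rtrancl_trans symE)
  define S where "S = {s \<in> R - C. \<exists>y\<in>C. (y, s) \<in> parcs G}"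
  have xS: "(x, s) \<in> parcs G" if "s \<in> S" for s
  proof -
    from that obtain y where y: "y \<in> C" "(y, s) \<in> parcs G" and s: "s \<in> R" "s \<notin> C" by (auto simp: S_def)
    have "s \<notin> H" using closed y s by blast
    moreover have "s \<noteq> x" using y CH sym by (auto simp: H_def)
    ultimately show ?thesis using s by (auto simp: H_def)
  qed
  have S_clique: "(s, t) \<in> parcs G" if st: "s \<in> S" "t \<in> S" "s \<noteq> t" for s t
  proof -
    from st obtain c1 c2 where "c1 \<in> C" "c2 \<in> C" "(s, c1) \<in> parcs G" "(c2, t) \<in> parcs G" "s \<notin> C" "t \<notin> C"
      by (auto simp: S_def dest: sym)
    then show ?thesis
      using chordal_separator_adjacent[OF G ch conn[unfolded rC_def], of x s t c1 c2] CH xS st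
      by (auto simp: H_def)
  qed
  define R' where "R' = C \<union> S"
  have R'R: "R' \<subseteq> R - {x}" using CH xS no_loops' by (auto simp: R'_def H_def S_def)
  then have fin: "finite R'" and card: "card R' < card R"
    using less.prems by (auto intro: finite_subset psubset_card_mono)
  \<comment> \<open>\<open>S\<close> contains all outer neighbours of \<open>C\<close> in
    \<open>R\<close>, so a vertex of \<open>C\<close> has the same neighbours in \<open>R\<close> as
    in \<open>R'\<close>.\<close>
  have lift: "simplicial (parcs G) R y" if "y \<in> C" "simplicial (parcs G) R' y" for y
  proof -
    have "a \<in> R'" if "a \<in> R" "(y, a) \<in> parcs G" for a
      using that \<open>y \<in> C\<close> by (auto simp: R'_def S_def)
    with that show ?thesis by (auto simp: simplicial_def)
  qed
  \<comment> \<open>The induction hypothesis is used at a vertex \<open>s\<close> with a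
    non-neighbour in \<open>R'\<close>. If \<open>s\<close> is in \<open>S\<close>, the vertex found
    is not adjacent to \<open>s\<close> and so lies outside the clique \<open>S\<close>. If only
    vertices of \<open>C\<close> have non-neighbours, then every vertex of \<open>S\<close> is
    adjacent to all others, so again the vertex found is not in \<open>S\<close>. If there is no
    such \<open>s\<close>, then \<open>R'\<close> is complete and \<open>z\<close> serves.\<close>
  have "\<exists>y\<in>C. simplicial (parcs G) R' y"
  proof (cases "\<exists>s\<in>S. \<exists>t\<in>R'. t \<noteq> s \<and> (s, t) \<notin> parcs G")
    case True
    then obtain s t where "s \<in> S" "t \<in> R'" "t \<noteq> s" "(s, t) \<notin> parcs G" by auto
    with less.hyps[OF card fin, of s t] S_clique show ?thesis by (auto simp: R'_def)
  next
    case univ: False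
    show ?thesis
    proof (cases "\<exists>s\<in>C. \<exists>t\<in>R'. t \<noteq> s \<and> (s, t) \<notin> parcs G")
      case True
      then obtain s t where s: "s \<in> C" "t \<in> R'" "t \<noteq> s" "(s, t) \<notin> parcs G" by auto
      with less.hyps[OF card fin, of s t] obtain y where
        y: "y \<in> R'" "y \<noteq> s" "(s, y) \<notin> parcs G" "simplicial (parcs G) R' y" by (auto simp: R'_def)
      have "s \<in> R'" using s by (simp add: R'_def)
      have "y \<notin> S"
      proof
        assume "y \<in> S"
        with univ \<open>s \<in> R'\<close> y(2) have "(y, s) \<in> parcs G" by metis
        with sym y(3) show False by simp
      qed
      with y show ?thesis by (auto simp: R'_def)
    next
      case False
      with univ have "(a, b) \<in> parcs G" if "a \<in> R'" "b \<in> R'" "a \<noteq> b" for a b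
        using that unfolding R'_def by (metis UnE)
      then have "simplicial (parcs G) R' z" by (simp add: simplicial_def)
      with zC show ?thesis by blast
    qed
  qed
  with lift CH show ?case by (auto simp: H_def)
qed

text \<open>Stated for an arbitrary remaining set \<open>R\<close>, so that repeated use produces a
  perfect elimination ordering.\<close>

lemma chordal_simplicial:
  assumes "pair_graph G" "chordal G" "finite R" "R \<noteq> {}"
  shows "\<exists>y\<in>R. simplicial (parcs G) R y"
proof (cases "\<exists>x\<in>R. \<exists>z\<in>R. z \<noteq> x \<and> (x, z) \<notin> parcs G")
  case True
  with chordal_simplicial_avoiding[OF assms(1-3)] show ?thesis by blast
next
  case False
  then have "simplicial (parcs G) R y" for y unfolding simplicial_def by metis
  with assms(4) show ?thesis by blast
qed

lemma clique_extends_to_maximal: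
  assumes "finite (pverts G)" "clique G S"
  shows "\<exists>T. maximal_clique G T \<and> S \<subseteq> T"
proof -
  have fin: "finite {T. clique G T \<and> S \<subseteq> T}"
    by (rule finite_subset[of _ "Pow (pverts G)"]) (use assms in \<open>auto simp: clique_def\<close>)
  from finite_has_maximal2[OF fin, of S] assms(2) obtain T where
    "clique G T" "S \<subseteq> T" "\<forall>U. clique G U \<and> S \<subseteq> U \<longrightarrow> T \<le> U \<longrightarrow> T = U" by auto
  then show ?thesis unfolding maximal_clique_def by (intro exI[of _ T]) blast
qed

subsection \<open>Clique decomposition of positive semidefinite forms\<close>

lemma sum_insert_both:
  fixes g :: "'a \<Rightarrow> 'a \<Rightarrow> real"
  assumes "finite S" "a \<notin> S"
  shows "(\<Sum>b\<in>insert a S. \<Sum>c\<in>insert a S. g b c)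
    = g a a + (\<Sum>c\<in>S. g a c) + (\<Sum>b\<in>S. g b a) + (\<Sum>b\<in>S. \<Sum>c\<in>S. g b c)"
  using assms by (simp add: sum.distrib)

lemma psd_diag_nonneg:
  fixes p :: "'a \<Rightarrow> 'a \<Rightarrow> real"
  assumes fin: "finite R" and psd: "\<And>f. 0 \<le> (\<Sum>b\<in>R. \<Sum>c\<in>R. f b * p b c * f c)" and a: "a \<in> R"
  shows "0 \<le> p a a"
proof -
  have "(\<Sum>b\<in>R. \<Sum>c\<in>R. (if b = a then 1 else 0) * p b c * (if c = a then 1 else 0))
      = (\<Sum>b\<in>R. \<Sum>c\<in>R. if c = a then if b = a then p a a else 0 else 0)"
    by (intro sum.cong refl) auto
  also have "\<dots> = p a a" using fin a by (simp add: sum.delta)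
  finally show ?thesis using psd[of "\<lambda>b. if b = a then 1 else 0"] by simp
qed

text \<open>On vectors with entry \<open>s\<close> at \<open>a\<close> and 1 at \<open>b\<close> the
  form is affine in \<open>s\<close> with slope \<open>2 * p a b\<close>, and a nonconstant affine
  function takes negative values. This is what makes a zero pivot harmless.\<close>

lemma psd_zero_diag:
  fixes p :: "'a \<Rightarrow> 'a \<Rightarrow> real"
  assumes fin: "finite R" and psd: "\<And>f. 0 \<le> (\<Sum>b\<in>R. \<Sum>c\<in>R. f b * p b c * f c)"
    and sym: "\<And>b c. b \<in> R \<Longrightarrow> c \<in> R \<Longrightarrow> p b c = p c b"
    and ab: "a \<in> R" "b \<in> R" and zero: "p a a = 0"
  shows "p a b = 0"
proof (rule ccontr)
  assume nz: "p a b \<noteq> 0"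
  then have neq: "a \<noteq> b" using zero by auto
  have "0 \<le> 2 * s * p a b + p b b" for s
  proof -
    define f where "f c = (if c = a then s else if c = b then 1 else 0)" for c
    let ?g = "\<lambda>c d. f c * p c d * f d"
    have "(\<Sum>c\<in>R. \<Sum>d\<in>R. ?g c d) = (\<Sum>c\<in>{a, b}. \<Sum>d\<in>{a, b}. ?g c d)"
    proof (rule sum.mono_neutral_cong_right)
      fix c assume "c \<in> {a, b}"
      show "(\<Sum>d\<in>R. ?g c d) = (\<Sum>d\<in>{a, b}. ?g c d)"
        by (rule sum.mono_neutral_cong_right) (use fin ab in \<open>auto simp: f_def\<close>)
    qed (use fin ab in \<open>auto simp: f_def\<close>)
    also have "\<dots> = 2 * s * p a b + p b b"
      using neq zero sym[OF ab(2,1)] by (simp add: f_def)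
    finally show ?thesis using psd[of f] by simp
  qed
  \<comment> \<open>This value of \<open>s\<close> makes the affine function equal to -1.\<close>
  from this[of "- (p b b + 1) / (2 * p a b)"] nz show False by (simp add: field_simps)
qed

text \<open>Symmetric Gaussian elimination along a perfect elimination ordering creates no fill-in, so
  every pivot row is supported in a single clique.\<close>

lemma psd_clique_decomposition:
  fixes p :: "'a \<Rightarrow> 'a \<Rightarrow> real"
  assumes elim: "\<And>R. R \<subseteq> V \<Longrightarrow> R \<noteq> {} \<Longrightarrow> \<exists>a\<in>R. \<exists>k\<in>I. {b \<in> R. adj a b} \<subseteq> cl k \<and>
      (\<forall>b\<in>R. \<forall>c\<in>R. adj a b \<longrightarrow> adj a c \<longrightarrow> adj b c)"
    and adj_refl: "\<And>a. a \<in> V \<Longrightarrow> adj a a"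
    and "finite R" "R \<subseteq> V"
    and "\<And>f. 0 \<le> (\<Sum>b\<in>R. \<Sum>c\<in>R. f b * p b c * f c)"
    and "\<And>b c. b \<in> R \<Longrightarrow> c \<in> R \<Longrightarrow> p b c = p c b"
    and "\<And>b c. b \<in> R \<Longrightarrow> c \<in> R \<Longrightarrow> \<not> adj b c \<Longrightarrow> p b c = 0"
  shows "\<exists>v \<kappa>. (\<forall>b\<in>R. \<forall>c\<in>R. p b c = (\<Sum>a\<in>R. v a b * v a c)) \<and>
    (\<forall>a\<in>R. \<kappa> a \<in> I \<and> (\<forall>b. v a b \<noteq> 0 \<longrightarrow> b \<in> R \<and> b \<in> cl (\<kappa> a)))"
  using assms(3-)
proof (induction "card R" arbitrary: R p)
  case 0
  then show ?case by auto
next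
  case (Suc n)
  note fin = \<open>finite R\<close> and psd = Suc.prems(3) and sym = Suc.prems(4) and supp = Suc.prems(5)
  from Suc.hyps(2) have "R \<noteq> {}" by auto
  from elim[OF \<open>R \<subseteq> V\<close> this] obtain a k where a: "a \<in> R" and k: "k \<in> I" "{b \<in> R. adj a b} \<subseteq> cl k"
    and simpl: "\<And>b c. b \<in> R \<Longrightarrow> c \<in> R \<Longrightarrow> adj a b \<Longrightarrow> adj a c \<Longrightarrow> adj b c"
    by (elim bexE conjE) blast
  define S where "S = R - {a}"
  have R: "R = insert a S" "a \<notin> S" and finS: "finite S" and SV: "S \<subseteq> V"
    using a fin Suc.prems(2) by (auto simp: S_def)
  have cardS: "n = card S" using Suc.hyps(2) R finS by simp
  have paa: "0 \<le> p a a" by (rule psd_diag_nonneg[OF fin psd a])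
  have pz: "p a b = 0" if "p a a = 0" "b \<in> R" for b by (rule psd_zero_diag[OF fin psd sym a that(2,1)])
  \<comment> \<open>The Schur complement of the pivot. For a zero pivot, division by zero yields 0,
    which fits because the pivot row vanishes.\<close>
  define p' where "p' b c = p b c - p a b * p a c / p a a" for b c
  have psd': "0 \<le> (\<Sum>b\<in>S. \<Sum>c\<in>S. f b * p' b c * f c)" for f
  proof -
    define s where "s = (\<Sum>b\<in>S. p a b * f b)"
    \<comment> \<open>For a positive pivot, the entry at \<open>a\<close> minimises the form over
      all extensions of \<open>f\<close>, so the form of \<open>p\<close> at \<open>g\<close> equals
      the form of \<open>p'\<close> at \<open>f\<close>. For a zero pivot both \<open>s\<close> and
      this entry are 0.\<close>
    define g where "g b = (if b = a then - s / p a a else f b)" for b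
    have s0: "s = 0" if "p a a = 0" using pz that R by (auto simp: s_def intro!: sum.neutral)
    have ss: "(\<Sum>b\<in>S. \<Sum>c\<in>S. f b * (p a b * p a c / p a a) * f c) = s * s / p a a"
      unfolding s_def sum_product by (simp add: sum_divide_distrib mult_ac)
    have gS: "g b = f b" if "b \<in> S" for b using that R by (auto simp: g_def)
    have row: "(\<Sum>c\<in>S. g a * p a c * g c) = g a * s"
      unfolding s_def sum_distrib_left by (intro sum.cong refl) (simp only: gS mult.assoc)
    have col: "(\<Sum>b\<in>S. g b * p b a * g a) = g a * s"
      unfolding s_def sum_distrib_left by (intro sum.cong refl) (use sym[OF _ a] R in \<open>simp add: gS mult_ac\<close>)
    have rest: "(\<Sum>b\<in>S. \<Sum>c\<in>S. g b * p b c * g c) = (\<Sum>b\<in>S. \<Sum>c\<in>S. f b * p b c * f c)"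
      by (intro sum.cong refl) (simp add: gS)
    have "0 \<le> (\<Sum>b\<in>R. \<Sum>c\<in>R. g b * p b c * g c)" by (rule psd)
    also have "\<dots> = g a * p a a * g a + g a * s + g a * s + (\<Sum>b\<in>S. \<Sum>c\<in>S. f b * p b c * f c)"
      unfolding R(1) sum_insert_both[OF finS R(2)] row col rest ..
    also have "g a * p a a * g a + g a * s + g a * s = - (s * s / p a a)"
      using s0 by (cases "p a a = 0") (simp_all add: g_def field_simps)
    also have "- (s * s / p a a) + (\<Sum>b\<in>S. \<Sum>c\<in>S. f b * p b c * f c) = (\<Sum>b\<in>S. \<Sum>c\<in>S. f b * p' b c * f c)"
      unfolding ss[symmetric] p'_def by (simp add: algebra_simps sum_subtractf)
    finally show ?thesis .
  qed
  have sym': "p' b c = p' c b" if "b \<in> S" "c \<in> S" for b c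
    using sym[of b c] that R by (simp add: p'_def mult.commute)
  \<comment> \<open>No fill-in: the correction at \<open>(b, c)\<close> is nonzero only if
    \<open>b\<close> and \<open>c\<close> are both neighbours of \<open>a\<close>, and then they are
    adjacent.\<close>
  have supp': "p' b c = 0" if "b \<in> S" "c \<in> S" "\<not> adj b c" for b c
  proof -
    have "p a b = 0 \<or> p a c = 0" using simpl[of b c] supp[OF a] that R by blast
    with supp[of b c] that R show ?thesis by (auto simp: p'_def)
  qed
  have "\<exists>v \<kappa>. (\<forall>b\<in>S. \<forall>c\<in>S. p' b c = (\<Sum>d\<in>S. v d b * v d c)) \<and>
      (\<forall>d\<in>S. \<kappa> d \<in> I \<and> (\<forall>b. v d b \<noteq> 0 \<longrightarrow> b \<in> S \<and> b \<in> cl (\<kappa> d)))"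
    by (rule Suc.hyps(1)[OF cardS finS SV psd' sym' supp'])
  then obtain v \<kappa> where
    v': "\<forall>b\<in>S. \<forall>c\<in>S. p' b c = (\<Sum>d\<in>S. v d b * v d c)"
    and \<kappa>': "\<forall>d\<in>S. \<kappa> d \<in> I \<and> (\<forall>b. v d b \<noteq> 0 \<longrightarrow> b \<in> S \<and> b \<in> cl (\<kappa> d))"
    by (elim exE conjE)
  have v: "p' b c = (\<Sum>d\<in>S. v d b * v d c)" if "b \<in> S" "c \<in> S" for b c
    using v' that by blast
  have \<kappa>: "\<kappa> d \<in> I" "v d b \<noteq> 0 \<Longrightarrow> b \<in> S \<and> b \<in> cl (\<kappa> d)" if "d \<in> S" for d b
    using \<kappa>' that by blast+
  \<comment> \<open>The pivot row divided by the root of the pivot; its square is the term removed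
    in \<open>p'\<close>. A zero pivot gives \<open>w = 0\<close>, again by division by zero.
    Cutting off outside \<open>R\<close> makes the support condition hold for every index.\<close>
  define w where "w b = (if b \<in> R then p a b / sqrt (p a a) else 0)" for b
  have ww: "w b * w c = p a b * p a c / p a a" if "b \<in> R" "c \<in> R" for b c
    using that paa by (simp add: w_def)
  let ?v = "v(a := w)" and ?\<kappa> = "\<kappa>(a := k)"
  have vsum: "(\<Sum>d\<in>R. ?v d b * ?v d c) = w b * w c + (\<Sum>d\<in>S. v d b * v d c)" for b c
  proof -
    have "(\<Sum>d\<in>S. ?v d b * ?v d c) = (\<Sum>d\<in>S. v d b * v d c)" using R by (intro sum.cong) auto
    then show ?thesis unfolding R(1) sum.insert[OF finS R(2)] by simp
  qed
  have va: "v d a = 0" if "d \<in> S" for d using \<kappa>(2)[OF that, of a] R by auto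
  have "p b c = (\<Sum>d\<in>R. ?v d b * ?v d c)" if bc: "b \<in> R" "c \<in> R" for b c
  proof (cases "b \<in> S \<and> c \<in> S")
    case True
    then show ?thesis unfolding vsum ww[OF bc] using v[of b c] by (simp add: p'_def)
  next
    case False
    then have disj: "b = a \<or> c = a" using bc R by auto
    have "(\<Sum>d\<in>S. v d b * v d c) = 0" using disj va by (auto intro!: sum.neutral)
    moreover have "p b c = p a b * p a c / p a a"
      using disj pz bc sym[of b c] a by (cases "p a a = 0") auto
    ultimately show ?thesis unfolding vsum ww[OF bc] by simp
  qed
  moreover have "?\<kappa> d \<in> I \<and> (\<forall>b. ?v d b \<noteq> 0 \<longrightarrow> b \<in> R \<and> b \<in> cl (?\<kappa> d))" if "d \<in> R" for d
  proof (cases "d = a")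
    case True
    have "b \<in> R \<and> b \<in> cl k" if "w b \<noteq> 0" for b
    proof -
      from that have "b \<in> R" "p a b \<noteq> 0" by (auto simp: w_def split: if_splits)
      with supp[OF a] k show ?thesis by blast
    qed
    with True k show ?thesis by simp
  next
    case False
    with \<kappa> that R show ?thesis by auto
  qed
  ultimately show ?case by (intro exI[of _ ?v] exI[of _ ?\<kappa>]) blast
qed

subsection \<open>Quadratic forms\<close>

text \<open>Variants of the matrix laws whose premises, unlike those on carriers, the simplifier can discharge.\<close>

lemma mat_assoc_dim:
  fixes A B C :: "real mat"
  shows "dim_col A = dim_row B \<Longrightarrow> dim_col B = dim_row C \<Longrightarrow> A * B * C = A * (B * C)"
  by (metis assoc_mult_mat carrier_mat_triv)

lemma mat_vec_assoc_dim:
  fixes A B :: "real mat"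
  shows "dim_col A = dim_row B \<Longrightarrow> dim_col B = dim_vec v \<Longrightarrow> A * B *\<^sub>v v = A *\<^sub>v (B *\<^sub>v v)"
  by (metis assoc_mult_mat_vec carrier_mat_triv carrier_vec_dim_vec)

lemma transpose_mult_dim:
  fixes A B :: "real mat"
  shows "dim_col A = dim_row B \<Longrightarrow> (A * B)\<^sup>T = B\<^sup>T * A\<^sup>T"
  by (metis transpose_mult carrier_mat_triv)

lemma transpose_add_dim:
  fixes A B :: "real mat"
  shows "dim_row A = dim_row B \<Longrightarrow> dim_col A = dim_col B \<Longrightarrow> (A + B)\<^sup>T = A\<^sup>T + B\<^sup>T"
  by (metis transpose_add carrier_mat_triv)

lemma mat_distrib_left_dim:
  fixes A B C :: "real mat"
  shows "dim_col A = dim_row B \<Longrightarrow> dim_row B = dim_row C \<Longrightarrow> dim_col B = dim_col C \<Longrightarrow>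
    A * (B + C) = A * B + A * C"
  by (metis mult_add_distrib_mat carrier_mat_triv)

lemma mat_distrib_right_dim:
  fixes A B C :: "real mat"
  shows "dim_col A = dim_row C \<Longrightarrow> dim_row A = dim_row B \<Longrightarrow> dim_col A = dim_col B \<Longrightarrow>
    (A + B) * C = A * C + B * C"
  by (metis add_mult_distrib_mat carrier_mat_triv)

lemma add_zero_mat_dim:
  fixes A :: "real mat"
  shows "dim_row A = n \<Longrightarrow> dim_col A = m \<Longrightarrow> A + 0\<^sub>m n m = A"
    and "dim_row A = n \<Longrightarrow> dim_col A = m \<Longrightarrow> 0\<^sub>m n m + A = A"
  by auto

lemma transpose_smult: "(c \<cdot>\<^sub>m A)\<^sup>T = c \<cdot>\<^sub>m A\<^sup>T"
  by (intro eq_matI) auto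

lemma smult_mult_mat_vec:
  fixes A :: "real mat"
  shows "dim_col A = dim_vec v \<Longrightarrow> (c \<cdot>\<^sub>m A) *\<^sub>v v = c \<cdot>\<^sub>v (A *\<^sub>v v)"
  by (intro eq_vecI) auto

lemmas mat_dim_simps = mat_assoc_dim mat_vec_assoc_dim transpose_mult_dim transpose_add_dim
  mat_distrib_left_dim mat_distrib_right_dim

lemma scalar_prod_self_pos:
  fixes x :: "real vec"
  assumes "x \<in> carrier_vec n" "x \<noteq> 0\<^sub>v n"
  shows "0 < x \<bullet> x"
  using conjugate_square_greater_0_vec[of x n] assms by simp

lemma scalar_prod_self_nonneg: "0 \<le> x \<bullet> (x :: real vec)"
  unfolding scalar_prod_def by (intro sum_nonneg) simp

lemma scalar_prod_mult_mat_vec: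
  fixes A :: "real mat"
  assumes "A \<in> carrier_mat m n" "x \<in> carrier_vec m" "y \<in> carrier_vec n"
  shows "x \<bullet> (A *\<^sub>v y) = (A\<^sup>T *\<^sub>v x) \<bullet> y"
  using assms by (simp add: transpose_vec_mult_scalar)

lemma scalar_prod_congruence:
  fixes X T :: "real mat"
  assumes X: "X \<in> carrier_mat m m" and T: "T \<in> carrier_mat m n" and x: "x \<in> carrier_vec n"
  shows "x \<bullet> ((T\<^sup>T * X * T) *\<^sub>v x) = (T *\<^sub>v x) \<bullet> (X *\<^sub>v (T *\<^sub>v x))"
proof -
  have "(T\<^sup>T * X * T) *\<^sub>v x = T\<^sup>T *\<^sub>v (X *\<^sub>v (T *\<^sub>v x))"
    using assms by (simp add: mat_dim_simps del: assoc_mult_mat assoc_mult_mat_vec)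
  also have "x \<bullet> \<dots> = (T *\<^sub>v x) \<bullet> (X *\<^sub>v (T *\<^sub>v x))"
    using assms by (subst scalar_prod_mult_mat_vec[of _ n m]) auto
  finally show ?thesis .
qed

lemma transpose_congruence:
  fixes X T :: "real mat"
  assumes "X \<in> carrier_mat m m" "X\<^sup>T = X" "T \<in> carrier_mat m n"
  shows "(T\<^sup>T * X * T)\<^sup>T = T\<^sup>T * X * T"
  using assms by (simp add: mat_dim_simps)

lemma left_invertible_nonzero:
  fixes T :: "real mat"
  assumes "T \<in> carrier_mat m n" "S \<in> carrier_mat n m" "S * T = 1\<^sub>m n" "x \<in> carrier_vec n" "x \<noteq> 0\<^sub>v n"
  shows "T *\<^sub>v x \<noteq> 0\<^sub>v m"
proof
  assume *: "T *\<^sub>v x = 0\<^sub>v m"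
  have "x = (S * T) *\<^sub>v x" using assms by simp
  also have "\<dots> = S *\<^sub>v 0\<^sub>v m" using assms(1,2,4) by (simp add: * assoc_mult_mat_vec[of _ n m])
  also have "\<dots> = 0\<^sub>v n" using assms(2) by auto
  finally show False using assms by simp
qed

text \<open>The left inverse makes \<open>T\<close> injective, so nonzero vectors stay nonzero. As
  \<open>T\<close> may be rectangular, this covers both the change of variables by \<open>Q\<close>
  and the compression by \<open>E\<close>.\<close>

lemma neg_def_congruence:
  assumes X: "X \<in> carrier_mat m m" "neg_def X"
    and T: "T \<in> carrier_mat m n" "S \<in> carrier_mat n m" "S * T = 1\<^sub>m n"
  shows "neg_def (T\<^sup>T * X * T)"
proof -
  have "x \<bullet> ((T\<^sup>T * X * T) *\<^sub>v x) < 0" if "x \<in> carrier_vec n" "x \<noteq> 0\<^sub>v n" for x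
    using left_invertible_nonzero[OF T that] X T(1) that
    unfolding scalar_prod_congruence[OF X(1) T(1) that(1)] by (auto simp: neg_def_def)
  then show ?thesis using transpose_congruence[OF X(1) _ T(1)] X T by (simp add: neg_def_def)
qed

lemma pos_def_congruence:
  assumes X: "X \<in> carrier_mat m m" "pos_def X"
    and T: "T \<in> carrier_mat m n" "S \<in> carrier_mat n m" "S * T = 1\<^sub>m n"
  shows "pos_def (T\<^sup>T * X * T)"
proof -
  have "x \<bullet> ((T\<^sup>T * X * T) *\<^sub>v x) > 0" if "x \<in> carrier_vec n" "x \<noteq> 0\<^sub>v n" for x
    using left_invertible_nonzero[OF T that] X T(1) that
    unfolding scalar_prod_congruence[OF X(1) T(1) that(1)] by (auto simp: pos_def_def)
  then show ?thesis using transpose_congruence[OF X(1) _ T(1)] X T by (simp add: pos_def_def)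
qed

text \<open>A kernel vector would contradict positivity, so the determinant is nonzero; the inverse
  \<open>Y\<close> is symmetric and equals \<open>Y\<^sup>T * X * Y\<close>, a congruence of
  \<open>X\<close>.\<close>

lemma pos_def_inverse:
  assumes X: "X \<in> carrier_mat n n" "pos_def X"
  shows "\<exists>Y\<in>carrier_mat n n. X * Y = 1\<^sub>m n \<and> Y * X = 1\<^sub>m n \<and> pos_def Y"
proof -
  have "det X \<noteq> 0"
  proof
    assume "det X = 0"
    then obtain v where "v \<in> carrier_vec n" "v \<noteq> 0\<^sub>v n" "X *\<^sub>v v = 0\<^sub>v n"
      using det_0_iff_vec_prod_zero_field[OF X(1)] by auto
    with X show False by (force simp: pos_def_def)
  qed
  from det_non_zero_imp_unit[OF X(1) this, of "()"] obtain Y where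
    Y: "Y \<in> carrier_mat n n" and XY: "X * Y = 1\<^sub>m n" and YX: "Y * X = 1\<^sub>m n"
    by (auto simp: Units_def ring_mat_def)
  have XT: "X\<^sup>T = X" using X by (simp add: pos_def_def)
  have "Y\<^sup>T * X = 1\<^sub>m n" using arg_cong[OF XY, of transpose_mat] X Y XT by (simp add: transpose_mult[of _ n n])
  moreover have "Y\<^sup>T * X * Y = Y\<^sup>T" using XY X Y by (simp add: mat_dim_simps)
  ultimately have "Y\<^sup>T = Y" using Y by simp
  with \<open>Y\<^sup>T * X = 1\<^sub>m n\<close> have "Y = Y\<^sup>T * X * Y" using Y by simp
  with pos_def_congruence[OF X Y X(1) XY] have "pos_def Y" by simp
  with Y XY YX show ?thesis by blast
qed

lemma quadratic_form_sum:
  assumes "X \<in> carrier_mat n n" "x \<in> carrier_vec n"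
  shows "x \<bullet> (X *\<^sub>v x) = (\<Sum>i<n. \<Sum>j<n. x $ i * X $$ (i, j) * (x $ j :: real))"
  using assms by (simp add: scalar_prod_def sum_distrib_left mult.assoc lessThan_atLeast0)

text \<open>Every product of two coordinates is at most \<open>x \<bullet> x\<close> in absolute
  value, so the sum of the absolute entries is a bound.\<close>

lemma quadratic_form_bounded:
  fixes X :: "real mat"
  assumes "X \<in> carrier_mat n n"
  shows "\<exists>\<beta>>0. \<forall>x\<in>carrier_vec n. x \<bullet> (X *\<^sub>v x) \<le> \<beta> * (x \<bullet> x)"
proof -
  \<comment> \<open>The added 1 only keeps the bound positive, so that it can be divided by
    later.\<close>
  let ?\<beta> = "(\<Sum>i<n. \<Sum>j<n. \<bar>X $$ (i, j)\<bar>) + 1"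
  have "x \<bullet> (X *\<^sub>v x) \<le> ?\<beta> * (x \<bullet> x)" if x: "x \<in> carrier_vec n" for x
  proof -
    have sq: "(x $ i)\<^sup>2 \<le> x \<bullet> x" if "i < n" for i
      using x that unfolding scalar_prod_def power2_eq_square
      by (intro member_le_sum[of i "{0..<dim_vec x}" "\<lambda>i. x $ i * x $ i"]) auto
    have "x $ i * X $$ (i, j) * x $ j \<le> \<bar>X $$ (i, j)\<bar> * (x \<bullet> x)" if "i < n" "j < n" for i j
    proof -
      have "\<bar>x $ i * x $ j\<bar> \<le> x \<bullet> x"
        using sum_squares_bound[of "\<bar>x $ i\<bar>" "\<bar>x $ j\<bar>"] sq[OF that(1)] sq[OF that(2)]
        by (simp add: abs_mult)
      then have "\<bar>X $$ (i, j)\<bar> * \<bar>x $ i * x $ j\<bar> \<le> \<bar>X $$ (i, j)\<bar> * (x \<bullet> x)"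
        by (intro mult_left_mono) auto
      moreover have "x $ i * X $$ (i, j) * x $ j \<le> \<bar>X $$ (i, j)\<bar> * \<bar>x $ i * x $ j\<bar>"
        using abs_ge_self[of "X $$ (i, j) * (x $ i * x $ j)"] by (simp only: abs_mult mult_ac)
      ultimately show ?thesis by linarith
    qed
    then have "(\<Sum>i<n. \<Sum>j<n. x $ i * X $$ (i, j) * x $ j) \<le> (\<Sum>i<n. \<Sum>j<n. \<bar>X $$ (i, j)\<bar> * (x \<bullet> x))"
      by (intro sum_mono) auto
    also have "\<dots> = (\<Sum>i<n. \<Sum>j<n. \<bar>X $$ (i, j)\<bar>) * (x \<bullet> x)" by (simp only: sum_distrib_right)
    finally show ?thesis
      unfolding quadratic_form_sum[OF assms x] distrib_right using scalar_prod_self_nonneg[of x] by linarith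
  qed
  moreover have "0 < ?\<beta>" by (simp add: sum_nonneg add_nonneg_pos)
  ultimately show ?thesis by blast
qed

lemma quadratic_form_add:
  fixes x y :: "real vec"
  assumes X: "X \<in> carrier_mat n n" "X\<^sup>T = X" and xy: "x \<in> carrier_vec n" "y \<in> carrier_vec n"
  shows "(x + y) \<bullet> (X *\<^sub>v (x + y)) = x \<bullet> (X *\<^sub>v x) + 2 * (x \<bullet> (X *\<^sub>v y)) + y \<bullet> (X *\<^sub>v y)"
proof -
  have "y \<bullet> (X *\<^sub>v x) = x \<bullet> (X *\<^sub>v y)"
    using scalar_prod_mult_mat_vec[OF X(1) xy(2,1)] X xy
    by (metis comm_scalar_prod mult_mat_vec_carrier)
  then show ?thesis
    using assms by (simp add: mult_add_distrib_mat_vec[of _ n n] add_scalar_prod_distrib[of _ n] scalar_prod_add_distrib[of _ n])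
qed

text \<open>Expand \<open>0 \<le> (x - s Yx) \<bullet> X(x - s Yx)\<close> with \<open>Y\<close> the inverse of \<open>X\<close> and \<open>s\<close> the reciprocal of
  a bound for the form of \<open>Y\<close>.\<close>

lemma pos_def_uniform:
  assumes X: "X \<in> carrier_mat n n" "pos_def X"
  shows "\<exists>\<alpha>>0. \<forall>x\<in>carrier_vec n. \<alpha> * (x \<bullet> x) \<le> x \<bullet> (X *\<^sub>v x)"
proof -
  obtain Y where Y: "Y \<in> carrier_mat n n" and XY: "X * Y = 1\<^sub>m n"
    using pos_def_inverse[OF X] by blast
  obtain \<beta> where \<beta>: "\<beta> > 0" "\<And>x. x \<in> carrier_vec n \<Longrightarrow> x \<bullet> (Y *\<^sub>v x) \<le> \<beta> * (x \<bullet> x)"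
    using quadratic_form_bounded[OF Y] by blast
  have XT: "X\<^sup>T = X" using X by (simp add: pos_def_def)
  have "1 / \<beta> * (x \<bullet> x) \<le> x \<bullet> (X *\<^sub>v x)" if x: "x \<in> carrier_vec n" for x
  proof -
    let ?s = "- (1 / \<beta>)"
    define y where "y = ?s \<cdot>\<^sub>v (Y *\<^sub>v x)"
    have Yx: "Y *\<^sub>v x \<in> carrier_vec n" using Y x by (rule mult_mat_vec_carrier)
    then have y: "y \<in> carrier_vec n" by (simp add: y_def)
    have "X *\<^sub>v (Y *\<^sub>v x) = x" using X Y XY x by (simp flip: assoc_mult_mat_vec[of _ n n])
    then have Xy: "X *\<^sub>v y = ?s \<cdot>\<^sub>v x" using X Y x by (simp add: y_def mult_mat_vec[of _ n n])
    have "0 \<le> (x + y) \<bullet> (X *\<^sub>v (x + y))"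
      using X x y by (cases "x + y = 0\<^sub>v n") (auto simp: pos_def_def less_imp_le)
    also have "\<dots> = x \<bullet> (X *\<^sub>v x) + 2 * (?s * (x \<bullet> x)) + ?s * ?s * (x \<bullet> (Y *\<^sub>v x))"
      unfolding quadratic_form_add[OF X(1) XT x y] Xy using x Yx
      by (simp add: y_def comm_scalar_prod[OF Yx x])
    also have "?s * ?s * (x \<bullet> (Y *\<^sub>v x)) \<le> ?s * ?s * (\<beta> * (x \<bullet> x))"
      using \<beta> x by (intro mult_left_mono) auto
    also have "?s * ?s * (\<beta> * (x \<bullet> x)) = 1 / \<beta> * (x \<bullet> x)" using \<beta>(1) by simp
    finally show ?thesis by simp
  qed
  with \<beta>(1) show ?thesis by (intro exI[of _ "1 / \<beta>"]) auto
qed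

lemma neg_def_uniform:
  assumes X: "X \<in> carrier_mat n n" "neg_def X"
  shows "\<exists>\<alpha>>0. \<forall>x\<in>carrier_vec n. x \<bullet> (X *\<^sub>v x) \<le> - (\<alpha> * (x \<bullet> x))"
proof -
  have um: "x \<bullet> ((- X) *\<^sub>v x) = - (x \<bullet> (X *\<^sub>v x))" if "x \<in> carrier_vec n" for x
    using X(1) that by (simp add: quadratic_form_sum[of _ n] sum_negf)
  have "pos_def (- X)"
    using X um by (auto simp: neg_def_def pos_def_def transpose_uminus)
  from pos_def_uniform[OF _ this, of n] X(1) um show ?thesis by (force simp: minus_le_iff)
qed

text \<open>Finsler's lemma: split \<open>z\<close> into \<open>F G z\<close>, where the form is uniformly negative, and the
  orthogonal rest, whose contribution a sufficiently negative \<open>\<rho>\<close> dominates.\<close>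

lemma finsler:
  fixes \<Phi> F G :: "real mat"
  assumes \<Phi>: "\<Phi> \<in> carrier_mat m m" "\<Phi>\<^sup>T = \<Phi>"
    and F: "F \<in> carrier_mat m n" and G: "G \<in> carrier_mat n m" and GF: "G * F = 1\<^sub>m n"
    and sym: "(F * G)\<^sup>T = F * G"
    and neg: "neg_def (F\<^sup>T * \<Phi> * F)"
  shows "\<exists>\<rho>. neg_def (\<Phi> + \<rho> \<cdot>\<^sub>m (1\<^sub>m m - F * G))"
proof -
  define Nm where "Nm = 1\<^sub>m m - F * G"
  have Nm: "Nm \<in> carrier_mat m m" using F G by (auto simp: Nm_def)
  have NmT: "Nm\<^sup>T = Nm" using F G sym by (simp add: Nm_def transpose_minus[of _ m m])
  obtain \<alpha>0 where \<alpha>0: "\<alpha>0 > 0" "\<And>x. x \<in> carrier_vec n \<Longrightarrow> x \<bullet> ((F\<^sup>T * \<Phi> * F) *\<^sub>v x) \<le> - (\<alpha>0 * (x \<bullet> x))"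
    using neg_def_uniform[OF _ neg, of n] \<Phi> F by auto
  obtain \<beta>0 where \<beta>0: "\<beta>0 > 0" "\<And>x. x \<in> carrier_vec n \<Longrightarrow> x \<bullet> ((F\<^sup>T * F) *\<^sub>v x) \<le> \<beta>0 * (x \<bullet> x)"
    using quadratic_form_bounded[of "F\<^sup>T * F" n] F by auto
  obtain \<beta>1 where \<beta>1: "\<beta>1 > 0" "\<And>x. x \<in> carrier_vec m \<Longrightarrow> x \<bullet> (\<Phi> *\<^sub>v x) \<le> \<beta>1 * (x \<bullet> x)"
    using quadratic_form_bounded[OF \<Phi>(1)] by auto
  obtain \<beta>2 where \<beta>2: "\<beta>2 > 0" "\<And>x. x \<in> carrier_vec m \<Longrightarrow> x \<bullet> ((\<Phi>\<^sup>T * \<Phi>) *\<^sub>v x) \<le> \<beta>2 * (x \<bullet> x)"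
    using quadratic_form_bounded[of "\<Phi>\<^sup>T * \<Phi>" m] \<Phi> by auto
  \<comment> \<open>Negativity is known in terms of the preimage \<open>g\<close>; dividing by
    \<beta>0 expresses it in terms of \<open>y = F g\<close>.\<close>
  define \<alpha> where "\<alpha> = \<alpha>0 / \<beta>0"
  have \<alpha>: "\<alpha> > 0" using \<alpha>0 \<beta>0 by (simp add: \<alpha>_def)
  \<comment> \<open>The three terms absorb, in this order, the part of the mixed term carried by
    \<open>t\<close>, the form of \<Phi> at \<open>t\<close>, and one unit of
    \<open>t \<bullet> t\<close> that keeps the final estimate strict.\<close>
  define \<rho> where "\<rho> = - (2 * \<beta>2 / \<alpha> + \<beta>1 + 1)"
  have "z \<bullet> ((\<Phi> + \<rho> \<cdot>\<^sub>m Nm) *\<^sub>v z) < 0" if z: "z \<in> carrier_vec m" "z \<noteq> 0\<^sub>v m" for z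
  proof -
    define g where "g = G *\<^sub>v z"
    define y where "y = F *\<^sub>v g"
    define t where "t = Nm *\<^sub>v z"
    have g: "g \<in> carrier_vec n" and y: "y \<in> carrier_vec m" and t: "t \<in> carrier_vec m"
      using F G Nm z by (auto simp: g_def y_def t_def)
    have y': "y = (F * G) *\<^sub>v z" using F G z by (simp add: y_def g_def)
    have t': "t = z - y" unfolding t_def Nm_def y' using F G z
      by (simp add: minus_mult_distrib_mat_vec[of _ m m])
    have zyt: "z = y + t" unfolding t' using z y by auto
    have "G *\<^sub>v y = g" unfolding y_def using F G GF g by (simp flip: assoc_mult_mat_vec[of _ n m])
    then have Ny: "Nm *\<^sub>v y = 0\<^sub>v m" unfolding Nm_def using F G y
      by (simp add: minus_mult_distrib_mat_vec[of _ m m]) (simp add: y_def)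
    have yt: "y \<bullet> t = 0" unfolding t_def scalar_prod_mult_mat_vec[OF Nm y z(1)] NmT Ny using z by simp
    have zt: "z \<bullet> t = t \<bullet> t" using yt zyt y t by (metis add_scalar_prod_distrib add_0)
    have \<Phi>y: "y \<bullet> (\<Phi> *\<^sub>v y) \<le> - (\<alpha> * (y \<bullet> y))"
    proof -
      have "y \<bullet> (\<Phi> *\<^sub>v y) \<le> - (\<alpha>0 * (g \<bullet> g))"
        using \<alpha>0(2)[OF g] unfolding scalar_prod_congruence[OF \<Phi>(1) F g] y_def .
      moreover have "y \<bullet> y = g \<bullet> ((F\<^sup>T * F) *\<^sub>v g)"
        unfolding y_def using F g by (simp add: scalar_prod_mult_mat_vec[of _ n m])
      then have "y \<bullet> y \<le> \<beta>0 * (g \<bullet> g)" using \<beta>0(2)[OF g] by simp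
      then have "\<alpha> * (y \<bullet> y) \<le> \<alpha>0 * (g \<bullet> g)" using \<alpha>0(1) \<beta>0(1)
        by (simp add: \<alpha>_def field_simps)
      ultimately show ?thesis by linarith
    qed
    \<comment> \<open>Young's inequality, from the square of
      \<open>\<alpha> / 2 \<cdot>\<^sub>v y - \<Phi> *\<^sub>v t\<close>. The weight is chosen to
      use up only half of the negativity available at \<open>y\<close>.\<close>
    have cross: "2 * (y \<bullet> (\<Phi> *\<^sub>v t)) \<le> \<alpha> / 2 * (y \<bullet> y) + 2 * \<beta>2 / \<alpha> * (t \<bullet> t)"
    proof -
      define s where "s = \<Phi> *\<^sub>v t"
      have s: "s \<in> carrier_vec m" using \<Phi> t by (auto simp: s_def)
      have "s \<bullet> s = t \<bullet> ((\<Phi>\<^sup>T * \<Phi>) *\<^sub>v t)" unfolding s_def using \<Phi>(1) t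
        by (simp add: scalar_prod_mult_mat_vec[of _ m m])
      then have ss: "s \<bullet> s \<le> \<beta>2 * (t \<bullet> t)" using \<beta>2(2)[OF t] by simp
      have "0 \<le> (\<alpha> / 2 \<cdot>\<^sub>v y - s) \<bullet> (\<alpha> / 2 \<cdot>\<^sub>v y - s)" by (rule scalar_prod_self_nonneg)
      also have "\<dots> = (\<alpha> / 2)\<^sup>2 * (y \<bullet> y) - \<alpha> * (y \<bullet> s) + s \<bullet> s"
        using y s by (simp add: minus_scalar_prod_distrib[of _ m] scalar_prod_minus_distrib[of _ m]
            comm_scalar_prod[of s m y] power2_eq_square algebra_simps)
      finally have "\<alpha> * (y \<bullet> s) \<le> (\<alpha> / 2)\<^sup>2 * (y \<bullet> y) + \<beta>2 * (t \<bullet> t)" using ss by linarith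
      then show ?thesis using \<alpha> unfolding s_def[symmetric] by (simp add: field_simps power2_eq_square)
    qed
    have "z \<bullet> ((\<Phi> + \<rho> \<cdot>\<^sub>m Nm) *\<^sub>v z) = z \<bullet> (\<Phi> *\<^sub>v z) + \<rho> * (z \<bullet> t)"
      unfolding t_def using \<Phi> Nm z
      by (simp add: add_mult_distrib_mat_vec[of _ m m] scalar_prod_add_distrib[of _ m] smult_mult_mat_vec)
    also have "z \<bullet> (\<Phi> *\<^sub>v z) = y \<bullet> (\<Phi> *\<^sub>v y) + 2 * (y \<bullet> (\<Phi> *\<^sub>v t)) + t \<bullet> (\<Phi> *\<^sub>v t)"
      unfolding zyt by (rule quadratic_form_add[OF \<Phi> y t])
    also have "\<dots> + \<rho> * (z \<bullet> t) \<le> - (\<alpha> / 2) * (y \<bullet> y) - t \<bullet> t"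
      using \<Phi>y cross \<beta>1(2)[OF t] unfolding zt \<rho>_def by (simp add: algebra_simps)
    also have "\<dots> < 0"
    proof (cases "y = 0\<^sub>v m")
      case True
      with zyt z t have "t \<noteq> 0\<^sub>v m" by auto
      with True t scalar_prod_self_pos[OF t] show ?thesis by simp
    next
      case False
      have "0 < \<alpha> / 2 * (y \<bullet> y)" using scalar_prod_self_pos[OF y False] \<alpha> by simp
      then show ?thesis using scalar_prod_self_nonneg[of t] by linarith
    qed
    finally show ?thesis .
  qed
  moreover have "(\<rho> \<cdot>\<^sub>m Nm)\<^sup>T = \<rho> \<cdot>\<^sub>m Nm" by (simp add: transpose_smult NmT)
  then have "(\<Phi> + \<rho> \<cdot>\<^sub>m Nm)\<^sup>T = \<Phi> + \<rho> \<cdot>\<^sub>m Nm" using \<Phi> Nm NmT by (simp add: transpose_add[of _ m m])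
  ultimately have "neg_def (\<Phi> + \<rho> \<cdot>\<^sub>m Nm)" using \<Phi> Nm by (simp add: neg_def_def)
  then show ?thesis unfolding Nm_def by blast
qed

subsection \<open>Block matrices\<close>

text \<open>The matrix diag(T, I, I), which changes the state coordinates only; \<open>T\<close> may
  be rectangular. It is nested like \<open>nine_block_mat\<close>, so that congruences follow from
  two uses of the four-block rule.\<close>

definition diag3 :: "real mat \<Rightarrow> nat \<Rightarrow> nat \<Rightarrow> real mat" where
  "diag3 T a b = four_block_mat
     (four_block_mat T (0\<^sub>m (dim_row T) a) (0\<^sub>m a (dim_col T)) (1\<^sub>m a)) (0\<^sub>m (dim_row T + a) b)
     (0\<^sub>m b (dim_col T + a)) (1\<^sub>m b)"

lemma diag3_carrier [simp]: "T \<in> carrier_mat m n \<Longrightarrow> diag3 T a b \<in> carrier_mat (m + a + b) (n + a + b)"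
  by (auto simp: diag3_def)

lemma diag3_one: "diag3 (1\<^sub>m n) a b = 1\<^sub>m (n + a + b)"
  by (intro eq_matI) (auto simp: diag3_def)

lemma four_block_diag_congruence:
  fixes X :: "real mat"
  assumes "V \<in> carrier_mat l m" "X \<in> carrier_mat m m'" "Y \<in> carrier_mat m b'" "Z \<in> carrier_mat b m'"
    "W \<in> carrier_mat b b'" "U \<in> carrier_mat m' n"
  shows "four_block_mat V (0\<^sub>m l b) (0\<^sub>m b m) (1\<^sub>m b) * four_block_mat X Y Z W *
      four_block_mat U (0\<^sub>m m' b') (0\<^sub>m b' n) (1\<^sub>m b') = four_block_mat (V * X * U) (V * Y) (Z * U) W"
proof -
  have 1: "four_block_mat V (0\<^sub>m l b) (0\<^sub>m b m) (1\<^sub>m b) * four_block_mat X Y Z W = four_block_mat (V * X) (V * Y) Z W"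
    by (subst mult_four_block_mat[OF assms(1) zero_carrier_mat zero_carrier_mat one_carrier_mat assms(2-5)])
      (use assms in \<open>auto simp: add_zero_mat_dim\<close>)
  show ?thesis unfolding 1
    by (subst mult_four_block_mat[OF _ _ assms(4,5) assms(6) zero_carrier_mat zero_carrier_mat one_carrier_mat])
      (use assms in \<open>auto simp: add_zero_mat_dim mult_carrier_mat[OF assms(1,2)] mult_carrier_mat[OF assms(1,3)]\<close>)
qed

lemma four_block_diag_mult:
  fixes S :: "real mat"
  assumes "S \<in> carrier_mat l m" "T \<in> carrier_mat m n" "P \<in> carrier_mat a b" "R \<in> carrier_mat b c"
  shows "four_block_mat S (0\<^sub>m l b) (0\<^sub>m a m) P * four_block_mat T (0\<^sub>m m c) (0\<^sub>m b n) R =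
    four_block_mat (S * T) (0\<^sub>m l c) (0\<^sub>m a n) (P * R)"
  by (subst mult_four_block_mat[OF assms(1) zero_carrier_mat zero_carrier_mat assms(3) assms(2) zero_carrier_mat zero_carrier_mat assms(4)])
    (use assms in \<open>auto simp: add_zero_mat_dim\<close>)

lemma diag3_mult:
  assumes S: "S \<in> carrier_mat l m" and T: "T \<in> carrier_mat m n"
  shows "diag3 S a b * diag3 T a b = diag3 (S * T) a b"
proof -
  have 1: "four_block_mat S (0\<^sub>m l a) (0\<^sub>m a m) (1\<^sub>m a) * four_block_mat T (0\<^sub>m m a) (0\<^sub>m a n) (1\<^sub>m a)
      = four_block_mat (S * T) (0\<^sub>m l a) (0\<^sub>m a n) (1\<^sub>m a)"
    using four_block_diag_mult[OF S T one_carrier_mat one_carrier_mat] by simp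
  have "four_block_mat S (0\<^sub>m l a) (0\<^sub>m a m) (1\<^sub>m a) \<in> carrier_mat (l + a) (m + a)"
    "four_block_mat T (0\<^sub>m m a) (0\<^sub>m a n) (1\<^sub>m a) \<in> carrier_mat (m + a) (n + a)"
    using S T by auto
  from four_block_diag_mult[OF this one_carrier_mat one_carrier_mat[of b]] show ?thesis
    using S T by (simp add: diag3_def 1)
qed

lemma transpose_diag3: "(diag3 T a b)\<^sup>T = diag3 (T\<^sup>T) a b"
proof -
  have "(four_block_mat T (0\<^sub>m (dim_row T) a) (0\<^sub>m a (dim_col T)) (1\<^sub>m a))\<^sup>T =
      four_block_mat (T\<^sup>T) (0\<^sub>m (dim_col T) a) (0\<^sub>m a (dim_row T)) (1\<^sub>m a)"
    by (subst transpose_four_block_mat[of T "dim_row T" "dim_col T" _ a _ a]) auto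
  then show ?thesis
    unfolding diag3_def
    by (subst transpose_four_block_mat[of _ "dim_row T + a" "dim_col T + a" _ b _ b]) auto
qed

lemma index_nine_block_mat:
  assumes "X11 \<in> carrier_mat n n" "X12 \<in> carrier_mat n a" "X13 \<in> carrier_mat n b"
    "X21 \<in> carrier_mat a n" "X22 \<in> carrier_mat a a" "X23 \<in> carrier_mat a b"
    "X31 \<in> carrier_mat b n" "X32 \<in> carrier_mat b a" "X33 \<in> carrier_mat b b"
    and "i < n + a + b" "j < n + a + b"
  shows "nine_block_mat X11 X12 X13 X21 X22 X23 X31 X32 X33 $$ (i, j) =
    (if i < n then if j < n then X11 $$ (i, j) else if j < n + a then X12 $$ (i, j - n) else X13 $$ (i, j - (n + a))
     else if i < n + a then if j < n then X21 $$ (i - n, j) else if j < n + a then X22 $$ (i - n, j - n) else X23 $$ (i - n, j - (n + a))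
     else if j < n then X31 $$ (i - (n + a), j) else if j < n + a then X32 $$ (i - (n + a), j - n) else X33 $$ (i - (n + a), j - (n + a)))"
  using assms unfolding nine_block_mat_def append_cols_def append_rows_def by auto

lemma nine_block_mat_carrier:
  assumes "X11 \<in> carrier_mat n n" "X22 \<in> carrier_mat a a" "X33 \<in> carrier_mat b b"
  shows "nine_block_mat X11 X12 X13 X21 X22 X23 X31 X32 X33 \<in> carrier_mat (n + a + b) (n + a + b)"
  using assms unfolding nine_block_mat_def by auto

lemma transpose_nine_block_mat:
  assumes X: "X11 \<in> carrier_mat n n" "X12 \<in> carrier_mat n a" "X13 \<in> carrier_mat n b"
    "X21 \<in> carrier_mat a n" "X22 \<in> carrier_mat a a" "X23 \<in> carrier_mat a b"
    "X31 \<in> carrier_mat b n" "X32 \<in> carrier_mat b a" "X33 \<in> carrier_mat b b"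
  shows "(nine_block_mat X11 X12 X13 X21 X22 X23 X31 X32 X33)\<^sup>T =
    nine_block_mat (X11\<^sup>T) (X21\<^sup>T) (X31\<^sup>T) (X12\<^sup>T) (X22\<^sup>T) (X32\<^sup>T) (X13\<^sup>T) (X23\<^sup>T) (X33\<^sup>T)" (is "?L\<^sup>T = ?R")
proof -
  have XT: "X11\<^sup>T \<in> carrier_mat n n" "X21\<^sup>T \<in> carrier_mat n a" "X31\<^sup>T \<in> carrier_mat n b"
    "X12\<^sup>T \<in> carrier_mat a n" "X22\<^sup>T \<in> carrier_mat a a" "X32\<^sup>T \<in> carrier_mat a b"
    "X13\<^sup>T \<in> carrier_mat b n" "X23\<^sup>T \<in> carrier_mat b a" "X33\<^sup>T \<in> carrier_mat b b"
    using X by auto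
  have L: "?L \<in> carrier_mat (n + a + b) (n + a + b)" using X by (intro nine_block_mat_carrier)
  have R: "?R \<in> carrier_mat (n + a + b) (n + a + b)" using XT by (intro nine_block_mat_carrier)
  show ?thesis
  proof (rule eq_matI)
    fix i j assume "i < dim_row ?R" "j < dim_col ?R"
    then have ij: "i < n + a + b" "j < n + a + b" using R by auto
    then show "?L\<^sup>T $$ (i, j) = ?R $$ (i, j)"
      using L X unfolding index_nine_block_mat[OF XT ij]
      by (simp add: index_nine_block_mat[OF X])
  qed (use L R in auto)
qed

lemma nine_block_mat_add_diag:
  assumes X: "X11 \<in> carrier_mat n n" "X12 \<in> carrier_mat n a" "X13 \<in> carrier_mat n b"
    "X21 \<in> carrier_mat a n" "X22 \<in> carrier_mat a a" "X23 \<in> carrier_mat a b"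
    "X31 \<in> carrier_mat b n" "X32 \<in> carrier_mat b a" "X33 \<in> carrier_mat b b"
    and R: "R \<in> carrier_mat n n"
  shows "nine_block_mat X11 X12 X13 X21 X22 X23 X31 X32 X33 + diag_block_mat [R, 0\<^sub>m a a, 0\<^sub>m b b] =
    nine_block_mat (X11 + R) X12 X13 X21 X22 X23 X31 X32 X33" (is "?L + ?D = ?R")
proof -
  have XR: "X11 + R \<in> carrier_mat n n" using R by simp
  have L: "?L \<in> carrier_mat (n + a + b) (n + a + b)" using X by (intro nine_block_mat_carrier)
  have R': "?R \<in> carrier_mat (n + a + b) (n + a + b)" using X XR by (intro nine_block_mat_carrier)
  have Deq: "?D = four_block_mat R (0\<^sub>m n (a + b)) (0\<^sub>m (a + b) n) (0\<^sub>m (a + b) (a + b))"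
    using R by (auto simp: Let_def)
  have D: "?D \<in> carrier_mat (n + a + b) (n + a + b)"
    unfolding Deq using four_block_carrier_mat[OF R zero_carrier_mat[of "a + b" "a + b"]] by (simp add: add.assoc)
  have Dij: "?D $$ (i, j) = (if i < n \<and> j < n then R $$ (i, j) else 0)" if "i < n + a + b" "j < n + a + b" for i j
    unfolding Deq using R that by simp
  show ?thesis
  proof (rule eq_matI)
    fix i j assume "i < dim_row ?R" "j < dim_col ?R"
    then have ij: "i < n + a + b" "j < n + a + b" using R' by auto
    then have "(?L + ?D) $$ (i, j) = ?L $$ (i, j) + (if i < n \<and> j < n then R $$ (i, j) else 0)"
      using D Dij[OF ij] by (simp del: diag_block_mat.simps)
    also have "\<dots> = ?R $$ (i, j)"
      unfolding index_nine_block_mat[OF X ij] index_nine_block_mat[OF XR X(2-) ij] using X R by auto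
    finally show "(?L + ?D) $$ (i, j) = ?R $$ (i, j)" .
  qed (use R' D in \<open>auto simp del: diag_block_mat.simps\<close>)
qed

text \<open>With \<open>S = E * L\<close> this identifies the penalty produced by Finsler's lemma
  with a \<rho>-term in the state block alone.\<close>

lemma one_minus_diag3:
  assumes S: "S \<in> carrier_mat n n"
  shows "\<rho> \<cdot>\<^sub>m (1\<^sub>m (n + a + b) - diag3 S a b) = diag_block_mat [\<rho> \<cdot>\<^sub>m (1\<^sub>m n - S), 0\<^sub>m a a, 0\<^sub>m b b]"
  using S by (intro eq_matI) (auto simp: diag3_def Let_def)

lemma nine_block_mat_congruence:
  assumes X: "X11 \<in> carrier_mat m m" "X12 \<in> carrier_mat m a" "X13 \<in> carrier_mat m b"
    "X21 \<in> carrier_mat a m" "X22 \<in> carrier_mat a a" "X23 \<in> carrier_mat a b"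
    "X31 \<in> carrier_mat b m" "X32 \<in> carrier_mat b a" "X33 \<in> carrier_mat b b"
    and T: "T \<in> carrier_mat m n"
  shows "(diag3 T a b)\<^sup>T * nine_block_mat X11 X12 X13 X21 X22 X23 X31 X32 X33 * diag3 T a b =
    nine_block_mat (T\<^sup>T * X11 * T) (T\<^sup>T * X12) (T\<^sup>T * X13) (X21 * T) X22 X23 (X31 * T) X32 X33"
proof -
  define U where "U = four_block_mat T (0\<^sub>m m a) (0\<^sub>m a n) (1\<^sub>m a)"
  define V where "V = four_block_mat (T\<^sup>T) (0\<^sub>m n a) (0\<^sub>m a m) (1\<^sub>m a)"
  have U: "U \<in> carrier_mat (m + a) (n + a)" and V: "V \<in> carrier_mat (n + a) (m + a)"
    using T by (auto simp: U_def V_def)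
  have dU: "diag3 T a b = four_block_mat U (0\<^sub>m (m + a) b) (0\<^sub>m b (n + a)) (1\<^sub>m b)"
    using T by (simp add: diag3_def U_def)
  have dV: "(diag3 T a b)\<^sup>T = four_block_mat V (0\<^sub>m (n + a) b) (0\<^sub>m b (m + a)) (1\<^sub>m b)"
    unfolding transpose_diag3 using T by (simp add: diag3_def V_def)
  let ?Y11 = "four_block_mat X11 X12 X21 X22" and ?Y12 = "X13 @\<^sub>r X23" and ?Y21 = "append_cols X31 X32"
  have Y: "?Y11 \<in> carrier_mat (m + a) (m + a)" "?Y12 \<in> carrier_mat (m + a) b" "?Y21 \<in> carrier_mat b (m + a)"
    using X by (auto simp: append_cols_def append_rows_def)
  have 1: "V * ?Y11 * U = four_block_mat (T\<^sup>T * X11 * T) (T\<^sup>T * X12) (X21 * T) X22"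
    unfolding U_def V_def using X T by (intro four_block_diag_congruence) auto
  have 2: "V * ?Y12 = (T\<^sup>T * X13) @\<^sub>r X23"
    unfolding V_def append_rows_def using X T
    by (subst mult_four_block_mat[where ?nr1.0 = n and ?n1.0 = m and ?n2.0 = a and ?nr2.0 = a and ?nc1.0 = b and ?nc2.0 = 0]) auto
  have 3: "?Y21 * U = append_cols (X31 * T) X32"
    unfolding U_def append_cols_def using X T
    by (subst mult_four_block_mat[where ?nr1.0 = b and ?n1.0 = m and ?n2.0 = a and ?nr2.0 = 0 and ?nc1.0 = n and ?nc2.0 = a])
      (auto simp: add_zero_mat_dim)
  show ?thesis
    unfolding dV unfolding dU nine_block_mat_def 1[symmetric] 2[symmetric] 3[symmetric]
    by (rule four_block_diag_congruence[OF V Y(1,2,3) X(9) U])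
qed

section \<open>Stacked rows and block diagonal matrices\<close>

lemma stack_rows_carrier:
  assumes "\<And>k. k \<in> set ks \<Longrightarrow> Es k \<in> carrier_mat (d k) n"
  shows "stack_rows n (map Es ks) \<in> carrier_mat (sum_list (map d ks)) n"
  using assms by (induction ks) (auto simp: stack_rows_def)

lemma diag_block_mat_carrier:
  assumes "\<And>k. k \<in> set ks \<Longrightarrow> P k \<in> carrier_mat (d k) (d k)"
  shows "diag_block_mat (map P ks) \<in> carrier_mat (sum_list (map d ks)) (sum_list (map d ks))"
  using assms by (induction ks) (auto simp: Let_def)

lemma diag_block_mat_mult:
  fixes P R :: "'k \<Rightarrow> real mat"
  assumes "\<And>k. k \<in> set ks \<Longrightarrow> P k \<in> carrier_mat (d k) (d k)" "\<And>k. k \<in> set ks \<Longrightarrow> R k \<in> carrier_mat (d k) (d k)"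
  shows "diag_block_mat (map P ks) * diag_block_mat (map R ks) = diag_block_mat (map (\<lambda>k. P k * R k) ks)"
  using assms
proof (induction ks)
  case (Cons k ks)
  let ?m = "sum_list (map d ks)" let ?D = "\<lambda>P. diag_block_mat (map P ks)"
  have D: "?D P \<in> carrier_mat ?m ?m" "?D R \<in> carrier_mat ?m ?m" "?D (\<lambda>k. P k * R k) \<in> carrier_mat ?m ?m"
    using Cons.prems by (auto intro!: diag_block_mat_carrier mult_carrier_mat)
  have PR: "P k \<in> carrier_mat (d k) (d k)" "R k \<in> carrier_mat (d k) (d k)" using Cons.prems by auto
  have IH: "?D P * ?D R = ?D (\<lambda>k. P k * R k)" using Cons by simp
  have "diag_block_mat (map X (k # ks)) = four_block_mat (X k) (0\<^sub>m (d k) ?m) (0\<^sub>m ?m (d k)) (?D X)"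
    if "X k \<in> carrier_mat (d k) (d k)" "?D X \<in> carrier_mat ?m ?m" for X
    using that by (simp add: Let_def)
  note this[of P, OF PR(1) D(1)] this[of R, OF PR(2) D(2)] this[of "\<lambda>k. P k * R k", OF mult_carrier_mat[OF PR] D(3)]
  then show ?case using four_block_diag_mult[OF PR D(1,2)] by (simp only: IH)
qed auto

lemma diag_block_mat_one: "diag_block_mat (map (\<lambda>k. 1\<^sub>m (d k)) ks) = (1\<^sub>m (sum_list (map d ks)) :: real mat)"
  by (induction ks) (auto simp: Let_def)

lemma pos_def_diag_block_mat:
  assumes "\<And>k. k \<in> set ks \<Longrightarrow> P k \<in> carrier_mat (d k) (d k)" "\<And>k. k \<in> set ks \<Longrightarrow> pos_def (P k)"
  shows "pos_def (diag_block_mat (map P ks))"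
  using assms
proof (induction ks)
  case Nil
  have "x = 0\<^sub>v 0" if "x \<in> carrier_vec 0" for x :: "real vec" using that by auto
  then show ?case by (auto simp: pos_def_def)
next
  case (Cons k ks)
  let ?m = "sum_list (map d ks)" let ?D = "diag_block_mat (map P ks)"
  have D: "?D \<in> carrier_mat ?m ?m" using Cons.prems by (auto intro!: diag_block_mat_carrier)
  have P: "P k \<in> carrier_mat (d k) (d k)" "pos_def (P k)" using Cons.prems by auto
  have pD: "pos_def ?D" using Cons by auto
  let ?X = "four_block_mat (P k) (0\<^sub>m (d k) ?m) (0\<^sub>m ?m (d k)) ?D"
  have X: "diag_block_mat (map P (k # ks)) = ?X" using D P by (simp add: Let_def)
  have "0 < x \<bullet> (?X *\<^sub>v x)" if x: "x \<in> carrier_vec (d k + ?m)" "x \<noteq> 0\<^sub>v (d k + ?m)" for x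
  proof -
    define y where "y = vec_first x (d k)"
    define z where "z = vec_last x ?m"
    have xyz: "x = y @\<^sub>v z" and y: "y \<in> carrier_vec (d k)" and z: "z \<in> carrier_vec ?m"
      using x by (auto simp: y_def z_def)
    have "x \<bullet> (?X *\<^sub>v x) = y \<bullet> (P k *\<^sub>v y) + z \<bullet> (?D *\<^sub>v z)"
      unfolding xyz mult_mat_vec_split[OF P(1) D y z] using y z P D
      by (intro scalar_prod_append) auto
    moreover have "y \<bullet> (P k *\<^sub>v y) \<ge> 0" "y \<noteq> 0\<^sub>v (d k) \<Longrightarrow> y \<bullet> (P k *\<^sub>v y) > 0"
      using P y by (cases "y = 0\<^sub>v (d k)"; auto simp: pos_def_def less_imp_le)+
    moreover have "z \<bullet> (?D *\<^sub>v z) \<ge> 0" "z \<noteq> 0\<^sub>v ?m \<Longrightarrow> z \<bullet> (?D *\<^sub>v z) > 0"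
      using pD D z by (cases "z = 0\<^sub>v ?m"; auto simp: pos_def_def less_imp_le)+
    moreover have "y \<noteq> 0\<^sub>v (d k) \<or> z \<noteq> 0\<^sub>v ?m"
    proof (rule ccontr)
      assume "\<not> ?thesis"
      then have "x = 0\<^sub>v (d k + ?m)" unfolding xyz by auto
      with x show False by simp
    qed
    ultimately show ?thesis by force
  qed
  moreover have "?X\<^sup>T = ?X"
    using P pD D by (subst transpose_four_block_mat[OF P(1) _ _ D]) (auto simp: pos_def_def)
  ultimately show ?case unfolding X using P D by (simp add: pos_def_def)
qed

text \<open>A block diagonal middle factor pairs each stacked block only with itself, so the
  contributions add up. It serves at two levels: cliques stacked in \<open>E\<close>, and nodes
  stacked in a clique.\<close>

lemma stack_rows_congruence:
  assumes "\<And>k. k \<in> set ks \<Longrightarrow> Es k \<in> carrier_mat (d k) n" "\<And>k. k \<in> set ks \<Longrightarrow> P k \<in> carrier_mat (d k) (d k)"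
    and "i < n" "j < n"
  shows "((stack_rows n (map Es ks))\<^sup>T * diag_block_mat (map P ks) * stack_rows n (map Es ks)) $$ (i, j) =
    (\<Sum>k\<leftarrow>ks. ((Es k)\<^sup>T * P k * Es k) $$ (i, j))"
  using assms(1,2)
proof (induction ks)
  case Nil
  then show ?case using assms(3,4) by (simp add: stack_rows_def scalar_prod_def)
next
  case (Cons k ks)
  let ?m = "sum_list (map d ks)" let ?D = "diag_block_mat (map P ks)" let ?S = "stack_rows n (map Es ks)"
  have D: "?D \<in> carrier_mat ?m ?m" using Cons.prems by (auto intro!: diag_block_mat_carrier)
  have S: "?S \<in> carrier_mat ?m n" using Cons.prems by (auto intro!: stack_rows_carrier)
  have P: "P k \<in> carrier_mat (d k) (d k)" and E: "Es k \<in> carrier_mat (d k) n" using Cons.prems by auto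
  \<comment> \<open>Stacking is a four-block matrix whose right column has width 0, which makes the
    four-block product rule applicable.\<close>
  have S': "stack_rows n (map Es (k # ks)) = four_block_mat (Es k) (0\<^sub>m (d k) 0) ?S (0\<^sub>m ?m 0)"
    using E S by (simp add: stack_rows_def append_rows_def)
  have ST: "(four_block_mat (Es k) (0\<^sub>m (d k) 0) ?S (0\<^sub>m ?m 0))\<^sup>T = four_block_mat ((Es k)\<^sup>T) (?S\<^sup>T) (0\<^sub>m 0 (d k)) (0\<^sub>m 0 ?m)"
    using E S by (subst transpose_four_block_mat) auto
  have D': "diag_block_mat (map P (k # ks)) = four_block_mat (P k) (0\<^sub>m (d k) ?m) (0\<^sub>m ?m (d k)) ?D"
    using D P by (simp add: Let_def)
  have 1: "four_block_mat ((Es k)\<^sup>T) (?S\<^sup>T) (0\<^sub>m 0 (d k)) (0\<^sub>m 0 ?m) * four_block_mat (P k) (0\<^sub>m (d k) ?m) (0\<^sub>m ?m (d k)) ?D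
    = four_block_mat ((Es k)\<^sup>T * P k) (?S\<^sup>T * ?D) (0\<^sub>m 0 (d k)) (0\<^sub>m 0 ?m)"
    using E S P D by (subst mult_four_block_mat[where ?nr1.0 = n and ?n1.0 = "d k" and ?n2.0 = ?m and ?nr2.0 = 0 and ?nc1.0 = "d k" and ?nc2.0 = ?m])
      (auto simp: mult_carrier_mat[of _ n "d k"] mult_carrier_mat[of _ n ?m])
  have 2: "four_block_mat ((Es k)\<^sup>T * P k) (?S\<^sup>T * ?D) (0\<^sub>m 0 (d k)) (0\<^sub>m 0 ?m) * four_block_mat (Es k) (0\<^sub>m (d k) 0) ?S (0\<^sub>m ?m 0)
    = four_block_mat ((Es k)\<^sup>T * P k * Es k + ?S\<^sup>T * ?D * ?S) (0\<^sub>m n 0) (0\<^sub>m 0 n) (0\<^sub>m 0 0)"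
    using E S P D by (subst mult_four_block_mat[where ?nr1.0 = n and ?n1.0 = "d k" and ?n2.0 = ?m and ?nr2.0 = 0 and ?nc1.0 = n and ?nc2.0 = 0])
      (auto simp: mult_carrier_mat[of _ n "d k"] mult_carrier_mat[of _ n ?m])
  have "(four_block_mat ((Es k)\<^sup>T * P k * Es k + ?S\<^sup>T * ?D * ?S) (0\<^sub>m n 0) (0\<^sub>m 0 n) (0\<^sub>m 0 0)) $$ (i, j)
    = ((Es k)\<^sup>T * P k * Es k) $$ (i, j) + (?S\<^sup>T * ?D * ?S) $$ (i, j)"
    using E S P D assms(3,4) by (simp del: index_mult_mat assoc_mult_mat add: index_mult_mat(2,3))
  then show ?case unfolding S' ST D' 1 2 using Cons by simp
qed

subsection \<open>The clique embedding\<close>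

text \<open>The node whose block contains position \<open>b\<close>:
  \<open>offset ns (Suc i)\<close> is where block \<open>i\<close> ends. It lets block conditions be
  read off single entries. The value 0 never occurs for a valid position, as
  \<open>offset ns 1\<close> is 0.\<close>

definition node :: "(nat \<Rightarrow> nat) \<Rightarrow> nat \<Rightarrow> nat" where
  "node ns b = (LEAST i. b < offset ns (Suc i))"

text \<open>Nodes start at 1, so \<open>ns 0\<close> is never counted; hence the guard.\<close>

lemma offset_Suc: "0 < i \<Longrightarrow> offset ns (Suc i) = offset ns i + ns i"
  by (simp add: offset_def atLeastLessThanSuc)

lemma offset_mono: "i \<le> j \<Longrightarrow> offset ns i \<le> offset ns j"
  by (auto simp: offset_def intro!: sum_mono2)

lemma total_dim_eq_offset: "total_dim N ns = offset ns (Suc N)"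
  by (simp add: total_dim_def offset_def atLeastLessThanSuc_atLeastAtMost)

lemma node_eqI:
  assumes "0 < i" "offset ns i \<le> b" "b < offset ns i + ns i"
  shows "node ns b = i"
  unfolding node_def
proof (rule Least_equality)
  show "b < offset ns (Suc i)" using assms by (simp add: offset_Suc)
  show "i \<le> j" if "b < offset ns (Suc j)" for j
    using that assms(2) offset_mono[of "Suc j" i ns] by (meson leD le_trans not_less_eq_eq)
qed

lemma node_bounds:
  assumes "b < total_dim N ns"
  shows "node ns b \<in> {1..N}" "offset ns (node ns b) \<le> b" "b < offset ns (node ns b) + ns (node ns b)"
proof -
  from assms have b: "b < offset ns (Suc N)" by (simp add: total_dim_eq_offset)
  have 1: "b < offset ns (Suc (node ns b))" unfolding node_def by (rule LeastI[of "\<lambda>i. b < offset ns (Suc i)", OF b])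
  have 2: "node ns b \<le> N" unfolding node_def by (rule Least_le[of "\<lambda>i. b < offset ns (Suc i)", OF b])
  have 3: "0 < node ns b" using 1 by (intro gr0I) (simp add: offset_def)
  then obtain j where j: "node ns b = Suc j" by (cases "node ns b") auto
  have "\<not> b < offset ns (Suc j)"
    unfolding node_def by (rule not_less_Least) (simp flip: node_def add: j)
  then show "node ns b \<in> {1..N}" "offset ns (node ns b) \<le> b" "b < offset ns (node ns b) + ns (node ns b)"
    using 1 2 3 j offset_Suc[OF 3, of ns] by auto
qed

lemma node_iff:
  assumes "b < total_dim N ns" "i \<in> {1..N}"
  shows "node ns b = i \<longleftrightarrow> offset ns i \<le> b \<and> b < offset ns i + ns i"
  using node_eqI[of i ns b] node_bounds[OF assms(1)] assms(2) by auto

lemma sparse_mats_iff: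
  "K \<in> sparse_mats N ns G \<longleftrightarrow> K \<in> carrier_mat (total_dim N ns) (total_dim N ns) \<and>
    (\<forall>b<total_dim N ns. \<forall>c<total_dim N ns. node ns b \<noteq> node ns c \<longrightarrow> (node ns b, node ns c) \<notin> parcs G \<longrightarrow> K $$ (b, c) = 0)"
    (is "_ \<longleftrightarrow> ?C \<and> ?Z")
proof
  assume K: "K \<in> sparse_mats N ns G"
  have "K $$ (b, c) = 0" if "b < total_dim N ns" "c < total_dim N ns" "node ns b \<noteq> node ns c" "(node ns b, node ns c) \<notin> parcs G" for b c
  proof -
    note b = node_bounds[OF that(1)] and c = node_bounds[OF that(2)]
    have "blk ns K (node ns b) (node ns c) = 0\<^sub>m (ns (node ns b)) (ns (node ns c))"
      using K that b(1) c(1) by (auto simp: sparse_mats_def)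
    then have "blk ns K (node ns b) (node ns c) $$ (b - offset ns (node ns b), c - offset ns (node ns c)) = 0"
      using b(2,3) c(2,3) by simp
    then show ?thesis using b(2,3) c(2,3) by (simp add: blk_def)
  qed
  then show "?C \<and> ?Z" using K by (auto simp: sparse_mats_def)
next
  assume K: "?C \<and> ?Z"
  have "blk ns K i j = 0\<^sub>m (ns i) (ns j)" if ij: "i \<in> {1..N}" "j \<in> {1..N}" "(i, j) \<notin> parcs G" "i \<noteq> j" for i j
  proof (rule eq_matI)
    fix a c assume "a < dim_row (0\<^sub>m (ns i) (ns j))" "c < dim_col (0\<^sub>m (ns i) (ns j))"
    then have a: "a < ns i" and c: "c < ns j" by auto
    have lt: "offset ns k + e < total_dim N ns" if "k \<in> {1..N}" "e < ns k" for k e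
      using that offset_Suc[of k ns] offset_mono[of "Suc k" "Suc N" ns] by (simp add: total_dim_eq_offset)
    have "node ns (offset ns i + a) = i" "node ns (offset ns j + c) = j"
      using ij a c by (auto intro: node_eqI)
    with K ij lt[OF ij(1) a] lt[OF ij(2) c] a c show "blk ns K i j $$ (a, c) = 0\<^sub>m (ns i) (ns j) $$ (a, c)"
      by (simp add: blk_def)
  qed (auto simp: blk_def)
  with K show "K \<in> sparse_mats N ns G" by (auto simp: sparse_mats_def)
qed

section \<open>Gram matrices of node and clique selectors\<close>

lemma E_node_carrier: "E_node N ns j \<in> carrier_mat (ns j) (total_dim N ns)"
  by (simp add: E_node_def)

lemma E_node_gram:
  assumes j: "j \<in> {1..N}" and bc: "b < total_dim N ns" "c < total_dim N ns"
  shows "((E_node N ns j)\<^sup>T * E_node N ns j) $$ (b, c) = (if b = c \<and> node ns b = j then 1 else 0)"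
proof -
  have "((E_node N ns j)\<^sup>T * E_node N ns j) $$ (b, c) =
      (\<Sum>a = 0..<ns j. (if b = offset ns j + a then 1 else 0) * (if c = offset ns j + a then 1 else 0))"
    using bc by (simp add: E_node_def scalar_prod_def)
  \<comment> \<open>At most one \<open>a\<close> contributes; the test
    \<open>offset ns j \<le> b\<close> guards against truncated subtraction.\<close>
  also have "\<dots> = (\<Sum>a = 0..<ns j. if a = b - offset ns j then (if b = c \<and> offset ns j \<le> b then 1 else 0) else 0)"
    by (intro sum.cong refl) auto
  also have "\<dots> = (if b = c \<and> node ns b = j then 1 else 0)"
    unfolding node_iff[OF bc(1) j] by (auto simp: sum.delta)
  finally show ?thesis .
qed

lemma E_clique_carrier:
  assumes "finite S"
  shows "E_clique N ns S \<in> carrier_mat (clique_dim ns S) (total_dim N ns)"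
proof -
  have "sum_list (map ns (sorted_list_of_set S)) = clique_dim ns S"
    using assms by (simp add: clique_dim_def sum_list_distinct_conv_sum_set)
  then show ?thesis
    unfolding E_clique_def using stack_rows_carrier[of "sorted_list_of_set S" "E_node N ns" ns "total_dim N ns"] E_node_carrier
    by simp
qed

text \<open>The identity, inserted as a block diagonal of identities, reduces the claim to the Gram
  matrices of the nodes, of which at most one contributes to a given entry.\<close>

lemma E_clique_gram:
  assumes S: "S \<subseteq> {1..N}" and bc: "b < total_dim N ns" "c < total_dim N ns"
  shows "((E_clique N ns S)\<^sup>T * E_clique N ns S) $$ (b, c) = (if b = c \<and> node ns b \<in> S then 1 else 0)"
proof -
  have fin: "finite S" using S finite_subset by blast
  let ?l = "sorted_list_of_set S" let ?D = "diag_block_mat (map (\<lambda>j. 1\<^sub>m (ns j) :: real mat) ?l)"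
  have dim: "sum_list (map ns ?l) = clique_dim ns S"
    using fin by (simp add: clique_dim_def sum_list_distinct_conv_sum_set)
  have D: "?D = 1\<^sub>m (clique_dim ns S)" unfolding diag_block_mat_one dim ..
  have "((E_clique N ns S)\<^sup>T * E_clique N ns S) $$ (b, c) = ((E_clique N ns S)\<^sup>T * ?D * E_clique N ns S) $$ (b, c)"
    unfolding D using E_clique_carrier[OF fin, of N ns] by simp
  also have "\<dots> = (\<Sum>j\<leftarrow>?l. ((E_node N ns j)\<^sup>T * 1\<^sub>m (ns j) * E_node N ns j) $$ (b, c))"
    unfolding E_clique_def by (rule stack_rows_congruence) (use bc E_node_carrier in auto)
  also have "\<dots> = (\<Sum>j\<in>S. ((E_node N ns j)\<^sup>T * 1\<^sub>m (ns j) * E_node N ns j) $$ (b, c))"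
    using fin by (simp add: sum_list_distinct_conv_sum_set)
  also have "\<dots> = (\<Sum>j\<in>S. if j = node ns b then if b = c then 1 else 0 else 0)"
  proof (rule sum.cong[OF refl])
    fix j assume "j \<in> S"
    then have j: "j \<in> {1..N}" using S by auto
    have "(E_node N ns j)\<^sup>T * 1\<^sub>m (ns j) = (E_node N ns j)\<^sup>T" using E_node_carrier[of N ns j] by simp
    then show "((E_node N ns j)\<^sup>T * 1\<^sub>m (ns j) * E_node N ns j) $$ (b, c) = (if j = node ns b then if b = c then 1 else 0 else 0)"
      using E_node_gram[OF j bc] by auto
  qed
  also have "\<dots> = (if b = c \<and> node ns b \<in> S then 1 else 0)" using fin by (simp add: sum.delta)
  finally show ?thesis .
qed

text \<open>A diagonal entry of the Gram matrix is the squared norm of a column. This spares any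
  computation of where a node's rows sit in the stack.\<close>

lemma E_clique_col_zero:
  assumes S: "S \<subseteq> {1..N}" and b: "b < total_dim N ns" "node ns b \<notin> S" and r: "r < clique_dim ns S"
  shows "E_clique N ns S $$ (r, b) = 0"
proof -
  have E: "E_clique N ns S \<in> carrier_mat (clique_dim ns S) (total_dim N ns)"
    using S finite_subset by (intro E_clique_carrier) blast
  have "(\<Sum>r = 0..<clique_dim ns S. E_clique N ns S $$ (r, b) * E_clique N ns S $$ (r, b)) = 0"
    using E_clique_gram[OF S b(1) b(1)] E b by (simp add: scalar_prod_def)
  then show ?thesis using r by (subst (asm) sum_nonneg_eq_0_iff) auto
qed

lemma E_clique_congruence_zero:
  assumes S: "S \<subseteq> {1..N}" and P: "P \<in> carrier_mat (clique_dim ns S) (clique_dim ns S)"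
    and bc: "b < total_dim N ns" "c < total_dim N ns" and out: "\<not> (node ns b \<in> S \<and> node ns c \<in> S)"
  shows "((E_clique N ns S)\<^sup>T * P * E_clique N ns S) $$ (b, c) = 0"
proof -
  have E: "E_clique N ns S \<in> carrier_mat (clique_dim ns S) (total_dim N ns)"
    using S finite_subset by (intro E_clique_carrier) blast
  show ?thesis
  proof (cases "node ns c \<in> S")
    case False
    then have "col (E_clique N ns S) c = 0\<^sub>v (clique_dim ns S)"
      using E bc E_clique_col_zero[OF S bc(2)] by (intro eq_vecI) auto
    then show ?thesis using E P bc by (simp del: assoc_mult_mat)
  next
    case True
    then have "col (E_clique N ns S) b = 0\<^sub>v (clique_dim ns S)"
      using E bc out E_clique_col_zero[OF S bc(1)] by (intro eq_vecI) auto
    then have "row ((E_clique N ns S)\<^sup>T * P) b = 0\<^sub>v (clique_dim ns S)"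
      using E P bc by (intro eq_vecI) auto
    then show ?thesis using E P bc by (simp del: assoc_mult_mat row_mult)
  qed
qed

text \<open>The linear algebra of \<open>E\<close> sees only a family of node sets covering all
  nodes; the graph enters in the final theorem.\<close>

locale clique_cover =
  fixes N q :: nat and ns :: "nat \<Rightarrow> nat" and Cl :: "nat \<Rightarrow> nat set"
  assumes Cl_nodes: "k \<in> {1..q} \<Longrightarrow> Cl k \<subseteq> {1..N}"
    and covered: "i \<in> {1..N} \<Longrightarrow> clique_idx q Cl i \<noteq> {}"
begin

abbreviation "n \<equiv> total_dim N ns"
abbreviation "d k \<equiv> clique_dim ns (Cl k)"
abbreviation "m \<equiv> \<Sum>k = 1..q. d k"
abbreviation "E \<equiv> E_mat N ns q Cl"
abbreviation "Ek k \<equiv> E_clique N ns (Cl k)"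
abbreviation "L \<equiv> left_inv E"
abbreviation "blkdiag P \<equiv> diag_block_mat (map P [1..<Suc q])"
abbreviation "cnt b \<equiv> real (card (clique_idx q Cl (node ns b)))"

lemma set_idx: "set [1..<Suc q] = {1..q}"
  by auto

lemma sum_list_idx: "sum_list (map f [1..<Suc q]) = (\<Sum>k = 1..q. f k)"
  for f :: "nat \<Rightarrow> 'b :: comm_monoid_add"
  by (metis set_idx distinct_upt sum_list_distinct_conv_sum_set)

lemma Ek_carrier: "k \<in> {1..q} \<Longrightarrow> Ek k \<in> carrier_mat (d k) n"
  using Cl_nodes finite_subset by (intro E_clique_carrier) blast

lemma E_carrier: "E \<in> carrier_mat m n"
  unfolding E_mat_def sum_list_idx[symmetric]
  by (rule stack_rows_carrier) (use Ek_carrier in auto)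

lemma blkdiag_carrier:
  assumes "\<And>k. k \<in> {1..q} \<Longrightarrow> P k \<in> carrier_mat (d k) (d k)"
  shows "blkdiag P \<in> carrier_mat m m"
  unfolding sum_list_idx[symmetric] by (rule diag_block_mat_carrier) (use assms in auto)

lemma blkdiag_mult:
  assumes "\<And>k. k \<in> {1..q} \<Longrightarrow> P k \<in> carrier_mat (d k) (d k)" "\<And>k. k \<in> {1..q} \<Longrightarrow> R k \<in> carrier_mat (d k) (d k)"
  shows "blkdiag P * blkdiag R = blkdiag (\<lambda>k. P k * (R k :: real mat))"
  by (rule diag_block_mat_mult[of _ _ d]) (use assms in auto)

lemma blkdiag_eq_one:
  assumes "\<And>k. k \<in> {1..q} \<Longrightarrow> P k = (1\<^sub>m (d k) :: real mat)"
  shows "blkdiag P = 1\<^sub>m m"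
proof -
  have "map P [1..<Suc q] = map (\<lambda>k. 1\<^sub>m (d k)) [1..<Suc q]" using assms by auto
  then show ?thesis unfolding sum_list_idx[symmetric] diag_block_mat_one[symmetric] by (simp only:)
qed

lemma blkdiag_pos_def:
  assumes "\<And>k. k \<in> {1..q} \<Longrightarrow> P k \<in> carrier_mat (d k) (d k)" "\<And>k. k \<in> {1..q} \<Longrightarrow> pos_def (P k)"
  shows "pos_def (blkdiag P)"
  by (rule pos_def_diag_block_mat[of _ _ d]) (use assms in auto)

lemma E_congruence:
  assumes "\<And>k. k \<in> {1..q} \<Longrightarrow> P k \<in> carrier_mat (d k) (d k)" "b < n" "c < n"
  shows "(E\<^sup>T * blkdiag P * E) $$ (b, c) = (\<Sum>k = 1..q. ((Ek k)\<^sup>T * P k * Ek k) $$ (b, c))"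
  unfolding sum_list_idx[symmetric] E_mat_def
  by (rule stack_rows_congruence[of _ _ d]) (use assms Ek_carrier in auto)

lemma card_idx: "(\<Sum>k = 1..q. if node ns b \<in> Cl k then 1 else 0) = cnt b"
proof -
  have "{k \<in> {1..q}. node ns b \<in> Cl k} = clique_idx q Cl (node ns b)" by (simp add: clique_idx_def)
  then show ?thesis by (simp flip: sum.inter_filter)
qed

lemma E_gram: "E\<^sup>T * E = mat_diag n cnt"
proof (rule eq_matI)
  fix b c assume "b < dim_row (mat_diag n cnt)" "c < dim_col (mat_diag n cnt)"
  then have bc: "b < n" "c < n" by (auto simp: mat_diag_def)
  have one: "blkdiag (\<lambda>k. 1\<^sub>m (d k)) = (1\<^sub>m m :: real mat)" by (rule blkdiag_eq_one) simp
  have "(E\<^sup>T * E) $$ (b, c) = (E\<^sup>T * blkdiag (\<lambda>k. 1\<^sub>m (d k)) * E) $$ (b, c)"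
    unfolding one using E_carrier by simp
  also have "\<dots> = (\<Sum>k = 1..q. ((Ek k)\<^sup>T * 1\<^sub>m (d k) * Ek k) $$ (b, c))"
    by (rule E_congruence) (use bc in auto)
  also have "\<dots> = (\<Sum>k = 1..q. if b = c \<and> node ns b \<in> Cl k then 1 else 0)"
  proof (rule sum.cong[OF refl])
    fix k assume k: "k \<in> {1..q}"
    have "(Ek k)\<^sup>T * 1\<^sub>m (d k) = (Ek k)\<^sup>T" using Ek_carrier[OF k] by simp
    then show "((Ek k)\<^sup>T * 1\<^sub>m (d k) * Ek k) $$ (b, c) = (if b = c \<and> node ns b \<in> Cl k then 1 else 0)"
      using E_clique_gram[OF Cl_nodes[OF k] bc] by simp
  qed
  also have "\<dots> = mat_diag n cnt $$ (b, c)"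
    using bc card_idx[of b] by (cases "b = c") (simp_all add: mat_diag_def del: One_nat_def)
  finally show "(E\<^sup>T * E) $$ (b, c) = mat_diag n cnt $$ (b, c)" .
qed (use E_carrier in \<open>auto simp: mat_diag_def\<close>)

lemma cnt_nonzero: "b < n \<Longrightarrow> card (clique_idx q Cl (node ns b)) \<noteq> 0"
  using covered[of "node ns b"] node_bounds(1)[of b N ns]
  by (auto simp: clique_idx_def)

lemma inv_gram: "inv_mat (E\<^sup>T * E) = mat_diag n (\<lambda>b. 1 / cnt b)"
proof (rule inv_mat_eqI)
  have "mat_diag n (\<lambda>b. cnt b * (1 / cnt b)) = 1\<^sub>m n"
    by (intro eq_matI) (auto simp: mat_diag_def cnt_nonzero)
  then show "E\<^sup>T * E * mat_diag n (\<lambda>b. 1 / cnt b) = 1\<^sub>m n" "mat_diag n (\<lambda>b. 1 / cnt b) * (E\<^sup>T * E) = 1\<^sub>m n"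
    unfolding E_gram by (simp_all add: mult.commute)
qed (auto simp: E_gram)

lemma L_carrier: "L \<in> carrier_mat n m"
  unfolding left_inv_def inv_gram using E_carrier by (intro mult_carrier_mat[of _ n n]) auto

lemma L_E: "L * E = 1\<^sub>m n"
proof -
  have "L * E = mat_diag n (\<lambda>b. 1 / cnt b) * (E\<^sup>T * E)"
    unfolding left_inv_def inv_gram using E_carrier by (intro assoc_mult_mat[of _ n n _ m _ n]) auto
  also have "\<dots> = 1\<^sub>m n"
    unfolding E_gram mat_diag_diag by (intro eq_matI) (auto simp: mat_diag_def cnt_nonzero)
  finally show ?thesis .
qed

lemma E_L_sym: "(E * L)\<^sup>T = E * L"
proof -
  have "(mat_diag n (\<lambda>b. 1 / cnt b))\<^sup>T = mat_diag n (\<lambda>b. 1 / cnt b)"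
    by (intro eq_matI) (auto simp: mat_diag_def)
  moreover have "dim_row E = m" "dim_col E = n" using E_carrier by auto
  ultimately show ?thesis unfolding left_inv_def inv_gram
    by (simp add: transpose_mult_dim mat_assoc_dim mat_diag_def)
qed

lemma M_E: "M_mat E * E = 0\<^sub>m m n"
proof -
  have "E * L * E = E" using E_carrier L_carrier L_E by (simp add: mat_assoc_dim)
  then show ?thesis unfolding M_mat_def using E_carrier L_carrier
    by (simp add: minus_mult_distrib_mat[of _ m m])
qed

lemma M_carrier: "M_mat E \<in> carrier_mat m m"
  unfolding M_mat_def using E_carrier L_carrier by (intro minus_carrier_mat) (auto intro: mult_carrier_mat)

text \<open>Since \<open>(Ek k)\<^sup>T * Ek k\<close> is a 0/1 diagonal matrix, the block
  \<open>Ek k * F * (Ek k)\<^sup>T\<close> contributes exactly the part of \<open>F\<close> inside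
  the clique.\<close>

lemma gram_sandwich:
  assumes k: "k \<in> {1..q}" and F: "F \<in> carrier_mat n n" and bc: "b < n" "c < n"
  shows "((Ek k)\<^sup>T * (Ek k * F * (Ek k)\<^sup>T) * Ek k) $$ (b, c) =
    (if node ns b \<in> Cl k \<and> node ns c \<in> Cl k then F $$ (b, c) else 0)"
proof -
  note E = Ek_carrier[OF k]
  let ?D = "mat_diag n (\<lambda>b. if node ns b \<in> Cl k then 1 else 0 :: real)"
  have D: "(Ek k)\<^sup>T * Ek k = ?D"
    using E by (intro eq_matI) (simp_all add: E_clique_gram[OF Cl_nodes[OF k]] mat_diag_def del: index_mult_mat(1))
  have "(Ek k)\<^sup>T * (Ek k * F * (Ek k)\<^sup>T) * Ek k = (Ek k)\<^sup>T * Ek k * F * ((Ek k)\<^sup>T * Ek k)"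
    using E F by (simp add: mat_dim_simps)
  also have "\<dots> $$ (b, c) = (if node ns b \<in> Cl k \<and> node ns c \<in> Cl k then F $$ (b, c) else 0)"
    unfolding D mat_diag_mult_left[OF F] using bc
    by (subst mat_diag_mult_right[of _ n]) auto
  finally show ?thesis .
qed

text \<open>An entry is reached by exactly those cliques that contain both of its nodes, so each of
  them is given an equal share.\<close>

lemma sparse_lift:
  assumes X: "X \<in> carrier_mat n n"
    and zero: "\<And>b c. b < n \<Longrightarrow> c < n \<Longrightarrow> clique_idx q Cl (node ns b) \<inter> clique_idx q Cl (node ns c) = {} \<Longrightarrow> X $$ (b, c) = 0"
  shows "\<exists>P. (\<forall>k\<in>{1..q}. P k \<in> carrier_mat (d k) (d k)) \<and> E\<^sup>T * blkdiag P * E = X"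
proof -
  define J where "J b c = clique_idx q Cl (node ns b) \<inter> clique_idx q Cl (node ns c)" for b c
  \<comment> \<open>If no clique contains both nodes, the quotient by 0 is 0, in agreement with
    \<open>zero\<close>.\<close>
  define F where "F = mat n n (\<lambda>(b, c). X $$ (b, c) / real (card (J b c)))"
  define P where "P k = Ek k * F * (Ek k)\<^sup>T" for k
  have F: "F \<in> carrier_mat n n" by (simp add: F_def)
  have P: "P k \<in> carrier_mat (d k) (d k)" if "k \<in> {1..q}" for k
    unfolding P_def using Ek_carrier[OF that] F by (metis mult_carrier_mat transpose_carrier_mat)
  have "E\<^sup>T * blkdiag P * E = X"
  proof (rule eq_matI)
    fix b c assume "b < dim_row X" "c < dim_col X"
    then have bc: "b < n" "c < n" using X by auto
    have finJ: "finite (J b c)" by (simp add: J_def clique_idx_def)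
    have Jeq: "J b c = {k \<in> {1..q}. node ns b \<in> Cl k \<and> node ns c \<in> Cl k}" by (auto simp: J_def clique_idx_def)
    have "(E\<^sup>T * blkdiag P * E) $$ (b, c) = (\<Sum>k = 1..q. ((Ek k)\<^sup>T * P k * Ek k) $$ (b, c))"
      by (rule E_congruence[OF P bc])
    also have "\<dots> = (\<Sum>k = 1..q. if node ns b \<in> Cl k \<and> node ns c \<in> Cl k then F $$ (b, c) else 0)"
      unfolding P_def by (intro sum.cong refl gram_sandwich F bc)
    also have "\<dots> = real (card (J b c)) * F $$ (b, c)"
      unfolding Jeq by (simp flip: sum.inter_filter)
    also have "\<dots> = X $$ (b, c)"
      using bc zero[OF bc] finJ by (cases "J b c = {}") (auto simp: F_def J_def[symmetric])
    finally show "(E\<^sup>T * blkdiag P * E) $$ (b, c) = X $$ (b, c)" .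
  qed (use E_carrier X in auto)
  with P show ?thesis by blast
qed

text \<open>Rank-one terms alone would only give semidefinite blocks. But
  \<open>E\<^sup>T * E\<close> is the image of identity blocks, so the multiple of it set aside
  beforehand returns as a positive multiple of the identity in every block.\<close>

lemma pos_def_lift:
  assumes X: "X \<in> carrier_mat n n" "pos_def X"
    and adj_refl: "\<And>b. b < n \<Longrightarrow> adj b b"
    and supp: "\<And>b c. b < n \<Longrightarrow> c < n \<Longrightarrow> \<not> adj b c \<Longrightarrow> X $$ (b, c) = 0"
    and elim: "\<And>R. R \<subseteq> {..<n} \<Longrightarrow> R \<noteq> {} \<Longrightarrow> \<exists>a\<in>R. \<exists>k\<in>{1..q}. {b \<in> R. adj a b} \<subseteq> {b. node ns b \<in> Cl k} \<and>
      (\<forall>b\<in>R. \<forall>c\<in>R. adj a b \<longrightarrow> adj a c \<longrightarrow> adj b c)"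
  shows "\<exists>P. (\<forall>k\<in>{1..q}. P k \<in> carrier_mat (d k) (d k) \<and> pos_def (P k)) \<and> E\<^sup>T * blkdiag P * E = X"
proof -
  let ?D = "mat_diag n cnt"
  obtain \<alpha> where \<alpha>: "\<alpha> > 0" "\<And>x. x \<in> carrier_vec n \<Longrightarrow> \<alpha> * (x \<bullet> x) \<le> x \<bullet> (X *\<^sub>v x)"
    using pos_def_uniform[OF X] by blast
  obtain \<beta> where \<beta>: "\<beta> > 0" "\<And>x. x \<in> carrier_vec n \<Longrightarrow> x \<bullet> (?D *\<^sub>v x) \<le> \<beta> * (x \<bullet> x)"
    using quadratic_form_bounded[OF mat_diag_dim] by blast
  \<comment> \<open>Balances the lower bound \<alpha> for \<open>X\<close> against the upper bound
    \<beta> for \<open>E\<^sup>T * E\<close>, so that the difference \<open>p\<close> stays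
    semidefinite.\<close>
  define \<epsilon> where "\<epsilon> = \<alpha> / \<beta>"
  have \<epsilon>: "\<epsilon> > 0" using \<alpha> \<beta> by (simp add: \<epsilon>_def)
  have XT: "X\<^sup>T = X" using X by (simp add: pos_def_def)
  define p where "p b c = X $$ (b, c) - \<epsilon> * ?D $$ (b, c)" for b c
  have psd: "0 \<le> (\<Sum>b\<in>{..<n}. \<Sum>c\<in>{..<n}. f b * p b c * f c)" for f
  proof -
    define x where "x = vec n f"
    have x: "x \<in> carrier_vec n" by (simp add: x_def)
    have "(\<Sum>b\<in>{..<n}. \<Sum>c\<in>{..<n}. f b * p b c * f c) = x \<bullet> (X *\<^sub>v x) - \<epsilon> * (x \<bullet> (?D *\<^sub>v x))"
      unfolding quadratic_form_sum[OF X(1) x] quadratic_form_sum[OF mat_diag_dim x]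
      by (simp add: p_def x_def algebra_simps sum_subtractf sum_distrib_left)
    moreover have "\<epsilon> * (x \<bullet> (?D *\<^sub>v x)) \<le> \<epsilon> * (\<beta> * (x \<bullet> x))"
      using \<beta>(2)[OF x] \<epsilon> by (intro mult_left_mono) auto
    moreover have "\<epsilon> * (\<beta> * (x \<bullet> x)) = \<alpha> * (x \<bullet> x)" using \<beta>(1) by (simp add: \<epsilon>_def)
    ultimately show ?thesis using \<alpha>(2)[OF x] by linarith
  qed
  have sym: "p b c = p c b" if "b \<in> {..<n}" "c \<in> {..<n}" for b c
  proof -
    have "X $$ (b, c) = X\<^sup>T $$ (c, b)" using that X by simp
    then show ?thesis using that unfolding XT by (simp add: p_def mat_diag_def)
  qed
  have supp': "p b c = 0" if "b \<in> {..<n}" "c \<in> {..<n}" "\<not> adj b c" for b c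
    using supp[of b c] adj_refl[of b] that by (auto simp: p_def mat_diag_def)
  have "\<exists>v \<kappa>. (\<forall>b\<in>{..<n}. \<forall>c\<in>{..<n}. p b c = (\<Sum>a\<in>{..<n}. v a b * v a c)) \<and>
      (\<forall>a\<in>{..<n}. \<kappa> a \<in> {1..q} \<and> (\<forall>b. v a b \<noteq> 0 \<longrightarrow> b \<in> {..<n} \<and> b \<in> {b. node ns b \<in> Cl (\<kappa> a)}))"
    using elim adj_refl psd sym supp'
    by (intro psd_clique_decomposition[where V = "{..<n}" and adj = adj and cl = "\<lambda>k. {b. node ns b \<in> Cl k}"]) auto
  then obtain v \<kappa> where v': "\<forall>b\<in>{..<n}. \<forall>c\<in>{..<n}. p b c = (\<Sum>a\<in>{..<n}. v a b * v a c)"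
    and \<kappa>': "\<forall>a\<in>{..<n}. \<kappa> a \<in> {1..q} \<and> (\<forall>b. v a b \<noteq> 0 \<longrightarrow> b \<in> {..<n} \<and> b \<in> {b. node ns b \<in> Cl (\<kappa> a)})"
    by (elim exE conjE)
  have v: "p b c = (\<Sum>a<n. v a b * v a c)" if "b < n" "c < n" for b c
    using v' that by blast
  have \<kappa>: "\<kappa> a \<in> {1..q}" "v a b \<noteq> 0 \<Longrightarrow> node ns b \<in> Cl (\<kappa> a)" if "a < n" for a b
    using \<kappa>' that by blast+
  \<comment> \<open>Each rank-one term goes to the one clique chosen by \<kappa>; \<open>V k\<close>
    collects those of clique \<open>k\<close>.\<close>
  define V where "V k = mat n n (\<lambda>(b, c). \<Sum>a\<in>{a. a < n \<and> \<kappa> a = k}. v a b * v a c)" for k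
  have V: "V k \<in> carrier_mat n n" for k by (simp add: V_def)
  define P where "P k = \<epsilon> \<cdot>\<^sub>m 1\<^sub>m (d k) + Ek k * V k * (Ek k)\<^sup>T" for k
  have EVE: "Ek k * V k * (Ek k)\<^sup>T \<in> carrier_mat (d k) (d k)" if "k \<in> {1..q}" for k
    using Ek_carrier[OF that] V by (metis mult_carrier_mat transpose_carrier_mat)
  have P: "P k \<in> carrier_mat (d k) (d k)" if "k \<in> {1..q}" for k
    unfolding P_def using EVE[OF that] by simp
  have pd: "pos_def (P k)" if k: "k \<in> {1..q}" for k
  proof -
    note E = Ek_carrier[OF k]
    have ET: "(Ek k)\<^sup>T \<in> carrier_mat n (d k)" using E by simp
    have VT: "(V k)\<^sup>T = V k" by (intro eq_matI) (auto simp: V_def mult.commute)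
    have "(Ek k * V k * (Ek k)\<^sup>T)\<^sup>T = Ek k * V k * (Ek k)\<^sup>T"
      using transpose_congruence[OF V VT ET] by simp
    moreover have "(\<epsilon> \<cdot>\<^sub>m 1\<^sub>m (d k))\<^sup>T = \<epsilon> \<cdot>\<^sub>m 1\<^sub>m (d k)" by (simp add: transpose_smult)
    ultimately have PT: "(P k)\<^sup>T = P k"
      unfolding P_def using EVE[OF k] by (subst transpose_add[of _ "d k" "d k"]) auto
    have "0 < x \<bullet> (P k *\<^sub>v x)" if x: "x \<in> carrier_vec (d k)" "x \<noteq> 0\<^sub>v (d k)" for x
    proof -
      define y where "y = (Ek k)\<^sup>T *\<^sub>v x"
      have y: "y \<in> carrier_vec n" using ET x by (auto simp: y_def)
      \<comment> \<open>The form of \<open>V k\<close> is a sum of squares, one for each rank-one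
        term.\<close>
      have "0 \<le> (\<Sum>a\<in>{a. a < n \<and> \<kappa> a = k}. (\<Sum>b<n. v a b * y $ b)\<^sup>2)" by (intro sum_nonneg) auto
      also have "\<dots> = (\<Sum>a\<in>{a. a < n \<and> \<kappa> a = k}. \<Sum>b<n. \<Sum>c<n. y $ b * (v a b * v a c) * y $ c)"
        by (simp add: power2_eq_square sum_product mult_ac)
      also have "\<dots> = (\<Sum>b<n. \<Sum>c<n. \<Sum>a\<in>{a. a < n \<and> \<kappa> a = k}. y $ b * (v a b * v a c) * y $ c)"
        by (subst sum.swap) (intro sum.cong refl sum.swap)
      also have "\<dots> = y \<bullet> (V k *\<^sub>v y)"
        unfolding quadratic_form_sum[OF V y] by (simp add: V_def sum_distrib_left sum_distrib_right)
      also have "\<dots> = x \<bullet> ((Ek k * V k * (Ek k)\<^sup>T) *\<^sub>v x)"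
        using scalar_prod_congruence[OF V ET x(1)] by (simp add: y_def)
      finally have "0 \<le> x \<bullet> ((Ek k * V k * (Ek k)\<^sup>T) *\<^sub>v x)" .
      moreover have "x \<bullet> (P k *\<^sub>v x) = \<epsilon> * (x \<bullet> x) + x \<bullet> ((Ek k * V k * (Ek k)\<^sup>T) *\<^sub>v x)"
        unfolding P_def add_mult_distrib_mat_vec[OF smult_carrier_mat[OF one_carrier_mat] EVE[OF k] x(1)]
        using x EVE[OF k] mult_mat_vec_carrier[OF EVE[OF k] x(1)]
        by (simp add: scalar_prod_add_distrib[of _ "d k"] smult_mult_mat_vec del: assoc_mult_mat assoc_mult_mat_vec)
      moreover have "0 < \<epsilon> * (x \<bullet> x)" using \<epsilon> scalar_prod_self_pos[OF x] by simp
      ultimately show ?thesis by linarith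
    qed
    then show ?thesis using PT P[OF k] by (simp add: pos_def_def)
  qed
  have "E\<^sup>T * blkdiag P * E = X"
  proof (rule eq_matI)
    fix b c assume "b < dim_row X" "c < dim_col X"
    then have bc: "b < n" "c < n" using X by auto
    have entry: "((Ek k)\<^sup>T * P k * Ek k) $$ (b, c) =
        \<epsilon> * (if b = c \<and> node ns b \<in> Cl k then 1 else 0) + (\<Sum>a\<in>{a. a < n \<and> \<kappa> a = k}. v a b * v a c)" if k: "k \<in> {1..q}" for k
    proof -
      note E = Ek_carrier[OF k]
      have ET: "(Ek k)\<^sup>T \<in> carrier_mat n (d k)" using E by simp
      note G = mult_carrier_mat[OF ET E]
      note H = mult_carrier_mat[OF mult_carrier_mat[OF ET EVE[OF k]] E]
      have index: "(\<epsilon> \<cdot>\<^sub>m G + H) $$ (b, c) = \<epsilon> * G $$ (b, c) + H $$ (b, c)"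
        if "G \<in> carrier_mat n n" "H \<in> carrier_mat n n" for G H using that bc by simp
      have "\<epsilon> \<cdot>\<^sub>m 1\<^sub>m (d k) * Ek k = \<epsilon> \<cdot>\<^sub>m Ek k"
        using mult_smult_assoc_mat[OF one_carrier_mat E] E by simp
      moreover have "(Ek k)\<^sup>T * (\<epsilon> \<cdot>\<^sub>m Ek k) = \<epsilon> \<cdot>\<^sub>m ((Ek k)\<^sup>T * Ek k)"
        using E by (intro mult_smult_distrib[of _ n "d k"]) auto
      ultimately have "(Ek k)\<^sup>T * P k * Ek k = \<epsilon> \<cdot>\<^sub>m ((Ek k)\<^sup>T * Ek k) + (Ek k)\<^sup>T * (Ek k * V k * (Ek k)\<^sup>T) * Ek k"
        unfolding P_def using E V by (simp add: mat_dim_simps)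
      then have "((Ek k)\<^sup>T * P k * Ek k) $$ (b, c) =
          \<epsilon> * ((Ek k)\<^sup>T * Ek k) $$ (b, c) + ((Ek k)\<^sup>T * (Ek k * V k * (Ek k)\<^sup>T) * Ek k) $$ (b, c)"
        by (simp only: index[OF G H])
      \<comment> \<open>Restriction to the clique loses nothing, as the collected vectors vanish
        outside it.\<close>
      moreover have "((Ek k)\<^sup>T * (Ek k * V k * (Ek k)\<^sup>T) * Ek k) $$ (b, c) = (\<Sum>a\<in>{a. a < n \<and> \<kappa> a = k}. v a b * v a c)"
      proof (cases "node ns b \<in> Cl k \<and> node ns c \<in> Cl k")
        case True
        then show ?thesis unfolding gram_sandwich[OF k V bc] using bc by (simp add: V_def)
      next
        case False
        then have "v a b * v a c = 0" if "a < n" "\<kappa> a = k" for a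
          using \<kappa>(2)[OF that(1), of b] \<kappa>(2)[OF that(1), of c] that(2) by auto
        then have "(\<Sum>a\<in>{a. a < n \<and> \<kappa> a = k}. v a b * v a c) = 0" by (intro sum.neutral) auto
        then show ?thesis unfolding gram_sandwich[OF k V bc] if_not_P[OF False] by simp
      qed
      ultimately show ?thesis unfolding E_clique_gram[OF Cl_nodes[OF k] bc] by simp
    qed
    have "(E\<^sup>T * blkdiag P * E) $$ (b, c) = (\<Sum>k = 1..q. ((Ek k)\<^sup>T * P k * Ek k) $$ (b, c))"
      by (rule E_congruence[OF P bc])
    also have "\<dots> = \<epsilon> * (\<Sum>k = 1..q. if b = c \<and> node ns b \<in> Cl k then 1 else 0) +
        (\<Sum>k = 1..q. \<Sum>a\<in>{a. a < n \<and> \<kappa> a = k}. v a b * v a c)"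
      unfolding sum_distrib_left sum.distrib[symmetric] by (intro sum.cong refl entry)
    also have "(\<Sum>k = 1..q. if b = c \<and> node ns b \<in> Cl k then 1 else 0) = ?D $$ (b, c)"
      using bc card_idx[of b] by (cases "b = c") (simp_all add: mat_diag_def del: One_nat_def)
    \<comment> \<open>The fibres of \<kappa> partition the terms, so summing over cliques recovers
      all of them.\<close>
    also have "(\<Sum>k = 1..q. \<Sum>a\<in>{a. a < n \<and> \<kappa> a = k}. v a b * v a c) = p b c"
    proof -
      have "\<kappa> ` {..<n} \<subseteq> {1..q}" using \<kappa>(1) by blast
      from sum.group[OF _ _ this, of "\<lambda>a. v a b * v a c"] show ?thesis using v[OF bc] by simp
    qed
    also have "\<epsilon> * ?D $$ (b, c) + p b c = X $$ (b, c)" by (simp add: p_def)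
    finally show "(E\<^sup>T * blkdiag P * E) $$ (b, c) = X $$ (b, c)" .
  qed (use E_carrier X in auto)
  with P pd show ?thesis by blast
qed

end

subsection \<open>The lifted inequality\<close>

lemma He_eq:
  assumes "X \<in> carrier_mat n n"
  shows "He X = X\<^sup>T + X"
  unfolding He_def using assms by (intro comm_add_mat[of _ n n]) auto

text \<open>\<open>Q\<close> cancels its inverse \<open>Pt\<close> from either side, and the gain
  survives only in the product \<open>K * Q\<close>, the variable \<open>Z\<close> of the lifted
  inequality. \<open>R\<close> stands for the \<rho>-term.\<close>

lemma lifted_congruence_state:
  assumes c: "At \<in> carrier_mat m m" "Bt \<in> carrier_mat m m" "K \<in> carrier_mat m m" "Q \<in> carrier_mat m m" "Pt \<in> carrier_mat m m"
    "Bw \<in> carrier_mat m a" "Ct \<in> carrier_mat b m" "Dt \<in> carrier_mat b m" "R \<in> carrier_mat m m"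
    and X: "X22 \<in> carrier_mat a a" "X23 \<in> carrier_mat a b" "X32 \<in> carrier_mat b a" "X33 \<in> carrier_mat b b"
    and inv: "Q * Pt = 1\<^sub>m m" "Pt * Q = 1\<^sub>m m" and QT: "Q\<^sup>T = Q"
  shows "(diag3 Q a b)\<^sup>T * nine_block_mat
      ((At + Bt * K)\<^sup>T * Pt + Pt * (At + Bt * K) + R) (Pt * Bw) ((Ct + Dt * K)\<^sup>T)
      (Bw\<^sup>T * Pt) X22 X23 (Ct + Dt * K) X32 X33 * diag3 Q a b =
    nine_block_mat (He (At * Q + Bt * (K * Q)) + Q * R * Q) Bw (Q * Ct\<^sup>T + (K * Q)\<^sup>T * Dt\<^sup>T)
      (Bw\<^sup>T) X22 X23 (Ct * Q + Dt * (K * Q)) X32 X33"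
proof -
  define W where "W = At + Bt * K"
  have W: "W \<in> carrier_mat m m" unfolding W_def using c mult_carrier_mat[OF c(2,3)] by simp
  have QP: "Q * (Pt * Y) = Y" "Pt * (Q * Y) = Y" if "dim_row Y = m" for Y
    using that c inv by (simp_all flip: mat_assoc_dim)
  have W': "At * Q + Bt * (K * Q) = W * Q" unfolding W_def using c by (simp add: mat_dim_simps)
  have WQ: "W * Q \<in> carrier_mat m m" using mult_carrier_mat[OF W c(4)] .
  have DK: "Dt * K \<in> carrier_mat b m" using mult_carrier_mat[OF c(8,3)] .
  have V: "Ct + Dt * K \<in> carrier_mat b m" using DK by simp
  have V': "Ct * Q + Dt * (K * Q) = (Ct + Dt * K) * Q" using c by (simp add: mat_dim_simps)
  have 1: "Q\<^sup>T * (W\<^sup>T * Pt + Pt * W + R) * Q = He (W * Q) + Q * R * Q"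
    unfolding He_eq[OF WQ] using c W inv QT by (simp add: mat_dim_simps QP)
  have 2: "Q\<^sup>T * (Pt * Bw) = Bw" "Bw\<^sup>T * Pt * Q = Bw\<^sup>T"
    unfolding QT using c inv by (simp_all add: mat_assoc_dim QP)
  have 3: "Q\<^sup>T * (Ct + Dt * K)\<^sup>T = Q * Ct\<^sup>T + (K * Q)\<^sup>T * Dt\<^sup>T"
    using c by (simp add: mat_dim_simps QT)
  show ?thesis
    unfolding W_def[symmetric] W' V'
    by (subst nine_block_mat_congruence[of _ m _ a _ b])
      (use c X W V in \<open>auto simp: 1 2 3 mult_carrier_mat[of _ m m] mult_carrier_mat[of _ a m] simp del: assoc_mult_mat\<close>)
qed

text \<open>As \<open>L * E = 1\<^sub>m n\<close>, the lifted closed loop \<open>W\<close> and the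
  original one \<open>W0\<close> are intertwined: \<open>W * E = E * W0\<close>. The penalty drops
  out because \<open>R * E\<close> is zero.\<close>

lemma lifted_congruence_embedding:
  assumes c: "A \<in> carrier_mat n n" "B \<in> carrier_mat n n" "K \<in> carrier_mat m m" "Pt \<in> carrier_mat m m"
    "Bw \<in> carrier_mat n a" "C \<in> carrier_mat b n" "D \<in> carrier_mat b n" "R \<in> carrier_mat m m"
    and X: "X22 \<in> carrier_mat a a" "X23 \<in> carrier_mat a b" "X32 \<in> carrier_mat b a" "X33 \<in> carrier_mat b b"
    and E: "E \<in> carrier_mat m n" and L: "L \<in> carrier_mat n m" and LE: "L * E = 1\<^sub>m n" and RE: "R * E = 0\<^sub>m m n"
  shows "(diag3 E a b)\<^sup>T * nine_block_mat
      ((E * A * L + E * B * L * K)\<^sup>T * Pt + Pt * (E * A * L + E * B * L * K) + R) (Pt * (E * Bw)) ((C * L + D * L * K)\<^sup>T)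
      ((E * Bw)\<^sup>T * Pt) X22 X23 (C * L + D * L * K) X32 X33 * diag3 E a b =
    nine_block_mat ((A + B * (L * K * E))\<^sup>T * (E\<^sup>T * Pt * E) + (E\<^sup>T * Pt * E) * (A + B * (L * K * E)))
      (E\<^sup>T * Pt * E * Bw) ((C + D * (L * K * E))\<^sup>T)
      (Bw\<^sup>T * (E\<^sup>T * Pt * E)) X22 X23 (C + D * (L * K * E)) X32 X33"
proof -
  define W where "W = E * A * L + E * B * L * K"
  define V where "V = C * L + D * L * K"
  define W0 where "W0 = A + B * (L * K * E)"
  define V0 where "V0 = C + D * (L * K * E)"
  have dims [simp]: "dim_row A = n" "dim_col A = n" "dim_row B = n" "dim_col B = n" "dim_row K = m" "dim_col K = m"
    "dim_row Pt = m" "dim_col Pt = m" "dim_row Bw = n" "dim_col Bw = a" "dim_row C = b" "dim_col C = n"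
    "dim_row D = b" "dim_col D = n" "dim_row R = m" "dim_col R = m" "dim_row E = m" "dim_col E = n" "dim_row L = n" "dim_col L = m"
    using assms by auto
  have W: "W \<in> carrier_mat m m" and V: "V \<in> carrier_mat b m" and W0: "W0 \<in> carrier_mat n n" and V0: "V0 \<in> carrier_mat b n"
    unfolding W_def V_def W0_def V0_def by (intro carrier_matI; simp)+
  have dims' [simp]: "dim_row W = m" "dim_col W = m" "dim_row W0 = n" "dim_col W0 = n" using W W0 by auto
  have WE: "W * E = E * W0" and VE: "V * E = V0"
    unfolding W_def W0_def V_def V0_def by (simp_all add: mat_assoc_dim mat_distrib_left_dim mat_distrib_right_dim LE)
  have WET: "E\<^sup>T * W\<^sup>T = W0\<^sup>T * E\<^sup>T" using arg_cong[OF WE, of transpose_mat] by (simp add: transpose_mult_dim)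
  have 1: "E\<^sup>T * (W\<^sup>T * Pt + Pt * W + R) * E = W0\<^sup>T * (E\<^sup>T * Pt * E) + (E\<^sup>T * Pt * E) * W0"
  proof -
    have "E\<^sup>T * (W\<^sup>T * Pt + Pt * W + R) * E = E\<^sup>T * W\<^sup>T * Pt * E + E\<^sup>T * Pt * (W * E) + E\<^sup>T * (R * E)"
      by (simp add: mat_assoc_dim mat_distrib_left_dim mat_distrib_right_dim)
    then show ?thesis unfolding WET WE RE by (simp add: mat_assoc_dim add_zero_mat_dim)
  qed
  have 2: "E\<^sup>T * (Pt * (E * Bw)) = E\<^sup>T * Pt * E * Bw" "(E * Bw)\<^sup>T * Pt * E = Bw\<^sup>T * (E\<^sup>T * Pt * E)"
    by (simp_all add: mat_assoc_dim transpose_mult_dim)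
  have 3: "E\<^sup>T * V\<^sup>T = V0\<^sup>T" unfolding VE[symmetric] using V by (simp add: transpose_mult_dim)
  have Y: "W\<^sup>T * Pt + Pt * W + R \<in> carrier_mat m m" "Pt * (E * Bw) \<in> carrier_mat m a" "V\<^sup>T \<in> carrier_mat m b"
    "(E * Bw)\<^sup>T * Pt \<in> carrier_mat a m"
    using V by (intro carrier_matI; simp)+
  show ?thesis
    unfolding W_def[symmetric] V_def[symmetric] W0_def[symmetric] V0_def[symmetric]
      nine_block_mat_congruence[OF Y(1-3) Y(4) X(1,2) V X(3,4) E] 1 2 3 VE ..
qed

lemma neg_def_congruence_cancel:
  assumes X: "X \<in> carrier_mat m m" and T: "T \<in> carrier_mat m m" "S \<in> carrier_mat m m" "T * S = 1\<^sub>m m"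
    and neg: "neg_def (T\<^sup>T * X * T)"
  shows "neg_def X"
proof -
  have "S\<^sup>T * T\<^sup>T = 1\<^sub>m m" using transpose_mult[OF T(1,2)] unfolding T(3) by simp
  then have ST: "S\<^sup>T * (T\<^sup>T * Y) = Y" if "dim_row Y = m" for Y
    using that T by (simp flip: mat_assoc_dim)
  have "S\<^sup>T * (T\<^sup>T * X * T) * S = X"
    using X T by (simp add: mat_assoc_dim ST)
  moreover have "T\<^sup>T * X * T \<in> carrier_mat m m" using X T by (intro carrier_matI) auto
  moreover have "S * T = 1\<^sub>m m" using T mat_mult_left_right_inverse by blast
  ultimately show ?thesis using neg_def_congruence[of "T\<^sup>T * X * T" m S m T] T neg by simp
qed

context clique_cover
begin

text \<open>Holds for any \<open>K\<close> and any symmetric pair of mutually inverse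
  \<open>P\<close> and \<open>Q\<close>; block structure, sparsity and positivity are left to the
  lifting lemmas.\<close>

lemma lifted_inequality_iff:
  assumes A: "A \<in> carrier_mat n n" and B: "B \<in> carrier_mat n n" and Bw: "Bw \<in> carrier_mat n a"
    and C: "C \<in> carrier_mat b n" and D: "D \<in> carrier_mat b n" and Dw: "Dw \<in> carrier_mat b a"
    and K: "K \<in> carrier_mat m m" and Q: "Q \<in> carrier_mat m m" "Q\<^sup>T = Q" and P: "P \<in> carrier_mat m m" "P\<^sup>T = P"
    and inv: "Q * P = 1\<^sub>m m" "P * Q = 1\<^sub>m m"
  shows "(\<exists>\<rho>. neg_def (Gamma_mat A B Bw C D Dw \<gamma> E Q (K * Q) +
        diag_block_mat [\<rho> \<cdot>\<^sub>m (Q * M_mat E * Q), 0\<^sub>m (dim_col Bw) (dim_col Bw), 0\<^sub>m (dim_row C) (dim_row C)])) \<longleftrightarrow>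
    neg_def (brl_mat A B Bw C D Dw \<gamma> (L * K * E) (E\<^sup>T * P * E))"
    (is "(\<exists>\<rho>. neg_def (?G \<rho>)) \<longleftrightarrow> neg_def ?B")
proof -
  note E = E_carrier and L = L_carrier and M = M_carrier
  define At where "At = E * A * L"
  define Bt where "Bt = E * B * L"
  define Ct where "Ct = C * L"
  define Dt where "Dt = D * L"
  define W where "W = At + Bt * K"
  define V where "V = Ct + Dt * K"
  have t: "At \<in> carrier_mat m m" "Bt \<in> carrier_mat m m" "Ct \<in> carrier_mat b m" "Dt \<in> carrier_mat b m"
    unfolding At_def Bt_def Ct_def Dt_def using A B C D E L by (intro carrier_matI; simp)+
  have W: "W \<in> carrier_mat m m" and V: "V \<in> carrier_mat b m"
    unfolding W_def V_def using t K by (intro carrier_matI; simp)+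
  have EBw: "E * Bw \<in> carrier_mat m a" using mult_carrier_mat[OF E Bw] .
  let ?X22 = "(- \<gamma>) \<cdot>\<^sub>m 1\<^sub>m a" and ?X33 = "(- \<gamma>) \<cdot>\<^sub>m 1\<^sub>m b"
  have X: "?X22 \<in> carrier_mat a a" "Dw\<^sup>T \<in> carrier_mat a b" "Dw \<in> carrier_mat b a" "?X33 \<in> carrier_mat b b"
    using Dw by auto
  \<comment> \<open>The form between the two inequalities, in terms of \<open>P\<close> and
    \<open>K\<close>. The penalty is a parameter because Finsler's lemma starts from the zero
    penalty.\<close>
  define \<Omega>' where "\<Omega>' R = nine_block_mat (W\<^sup>T * P + P * W + R) (P * (E * Bw)) (V\<^sup>T)
      ((E * Bw)\<^sup>T * P) ?X22 (Dw\<^sup>T) V Dw ?X33" for R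
  define \<Omega> where "\<Omega> \<rho> = \<Omega>' (\<rho> \<cdot>\<^sub>m M_mat E)" for \<rho>
  have Y: "P * (E * Bw) \<in> carrier_mat m a" "V\<^sup>T \<in> carrier_mat m b" "(E * Bw)\<^sup>T * P \<in> carrier_mat a m"
    using P V E Bw by (intro carrier_matI; simp)+
  have Y11: "W\<^sup>T * P + P * W \<in> carrier_mat m m" using W P by (intro carrier_matI; simp)
  have \<Omega>'_carrier: "\<Omega>' R \<in> carrier_mat (m + a + b) (m + a + b)" if "R \<in> carrier_mat m m" for R
    unfolding \<Omega>'_def using that X by (intro nine_block_mat_carrier) auto
  have \<rho>M: "\<rho> \<cdot>\<^sub>m M_mat E \<in> carrier_mat m m" for \<rho> using M by simp
  have G: "(diag3 Q a b)\<^sup>T * \<Omega> \<rho> * diag3 Q a b = ?G \<rho>" for \<rho>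
  proof -
    have He: "He (At * Q + Bt * (K * Q)) \<in> carrier_mat m m"
      unfolding He_def using t K Q by (intro carrier_matI; simp)
    have QMQ: "Q * (\<rho> \<cdot>\<^sub>m M_mat E) * Q = \<rho> \<cdot>\<^sub>m (Q * M_mat E * Q)"
      using mult_smult_distrib[OF Q(1) M] mult_smult_assoc_mat[OF mult_carrier_mat[OF Q(1) M] Q(1)] by simp
    have QMQ_carrier: "\<rho> \<cdot>\<^sub>m (Q * M_mat E * Q) \<in> carrier_mat m m"
      using Q M by (intro carrier_matI; simp)
    have Z: "Q * Ct\<^sup>T + (K * Q)\<^sup>T * Dt\<^sup>T \<in> carrier_mat m b" "Ct * Q + Dt * (K * Q) \<in> carrier_mat b m"
      using t K Q by (intro carrier_matI; simp)+
    have EBwT: "(E * Bw)\<^sup>T \<in> carrier_mat a m" unfolding transpose_carrier_mat by (rule EBw)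
    have "(diag3 Q a b)\<^sup>T * \<Omega> \<rho> * diag3 Q a b =
        nine_block_mat (He (At * Q + Bt * (K * Q)) + \<rho> \<cdot>\<^sub>m (Q * M_mat E * Q)) (E * Bw) (Q * Ct\<^sup>T + (K * Q)\<^sup>T * Dt\<^sup>T)
          ((E * Bw)\<^sup>T) ?X22 (Dw\<^sup>T) (Ct * Q + Dt * (K * Q)) Dw ?X33"
      unfolding \<Omega>_def \<Omega>'_def W_def V_def QMQ[symmetric]
      by (rule lifted_congruence_state[OF t(1,2) K Q(1) P(1) EBw t(3,4) \<rho>M X inv Q(2)])
    also have "\<dots> = ?G \<rho>"
      using Bw C unfolding Gamma_mat_def Let_def At_def[symmetric] Bt_def[symmetric] Ct_def[symmetric] Dt_def[symmetric]
      by (simp only: carrier_matD nine_block_mat_add_diag[OF He EBw Z(1) EBwT X(1,2) Z(2) X(3,4) QMQ_carrier])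
    finally show ?thesis .
  qed
  have brl: "(diag3 E a b)\<^sup>T * \<Omega> \<rho> * diag3 E a b = ?B" for \<rho>
  proof -
    have "\<rho> \<cdot>\<^sub>m M_mat E * E = 0\<^sub>m m n"
      using mult_smult_assoc_mat[OF M E] M_E by simp
    from lifted_congruence_embedding[OF A B K P(1) Bw C D \<rho>M X E L L_E this] show ?thesis
      unfolding \<Omega>_def \<Omega>'_def W_def V_def At_def Bt_def Ct_def Dt_def brl_mat_def using Bw C by simp
  qed
  have d3: "diag3 Q a b \<in> carrier_mat (m + a + b) (m + a + b)" "diag3 P a b \<in> carrier_mat (m + a + b) (m + a + b)"
    "diag3 E a b \<in> carrier_mat (m + a + b) (n + a + b)" "diag3 L a b \<in> carrier_mat (n + a + b) (m + a + b)"
    using Q P E L by auto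
  have QP: "diag3 Q a b * diag3 P a b = 1\<^sub>m (m + a + b)" "diag3 P a b * diag3 Q a b = 1\<^sub>m (m + a + b)"
    using diag3_mult[OF Q(1) P(1)] diag3_mult[OF P(1) Q(1)] inv by (simp_all add: diag3_one)
  have LE: "diag3 L a b * diag3 E a b = 1\<^sub>m (n + a + b)"
    unfolding diag3_mult[OF L E] L_E diag3_one ..
  have EL: "diag3 E a b * diag3 L a b = diag3 (E * L) a b" by (rule diag3_mult[OF E L])
  show ?thesis
  proof
    assume "\<exists>\<rho>. neg_def (?G \<rho>)"
    then obtain \<rho> where "neg_def (?G \<rho>)" by blast
    then have "neg_def (\<Omega> \<rho>)"
      unfolding G[symmetric] \<Omega>_def
      by (rule neg_def_congruence_cancel[OF \<Omega>'_carrier[OF \<rho>M] d3(1,2) QP(1)])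
    then show "neg_def ?B"
      unfolding brl[of \<rho>, symmetric] \<Omega>_def
      by (intro neg_def_congruence[OF \<Omega>'_carrier[OF \<rho>M] _ d3(3,4) LE])
  next
    assume neg: "neg_def ?B"
    let ?Z = "0\<^sub>m m m"
    have Z: "?Z \<in> carrier_mat m m" by simp
    have \<Omega>0: "\<Omega> 0 = \<Omega>' ?Z"
    proof -
      have "0 \<cdot>\<^sub>m M_mat E = ?Z" using M by (intro eq_matI) auto
      then show ?thesis unfolding \<Omega>_def by simp
    qed
    have \<Omega>'0: "\<Omega>' ?Z = nine_block_mat (W\<^sup>T * P + P * W) (P * (E * Bw)) (V\<^sup>T)
      ((E * Bw)\<^sup>T * P) ?X22 (Dw\<^sup>T) V Dw ?X33"
      unfolding \<Omega>'_def using Y11 by simp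
    have "(W\<^sup>T * P + P * W)\<^sup>T = P * W + W\<^sup>T * P"
      using W P by (simp add: transpose_add_dim transpose_mult_dim)
    also have "\<dots> = W\<^sup>T * P + P * W"
      by (rule comm_add_mat[of _ m m]) (use W P in \<open>intro carrier_matI; simp\<close>)+
    finally have S1: "(W\<^sup>T * P + P * W)\<^sup>T = W\<^sup>T * P + P * W" .
    have S2: "(P * (E * Bw))\<^sup>T = (E * Bw)\<^sup>T * P" "((E * Bw)\<^sup>T * P)\<^sup>T = P * (E * Bw)"
      using E Bw P by (simp_all add: transpose_mult_dim mat_assoc_dim)
    have sym: "(\<Omega>' ?Z)\<^sup>T = \<Omega>' ?Z"
      unfolding \<Omega>'0 transpose_nine_block_mat[OF Y11 Y(1,2,3) X(1,2) V X(3,4)] S1 S2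
      by (simp add: transpose_smult)
    \<comment> \<open>Symmetry makes diag(E L, I, I) an orthogonal projection, as Finsler's lemma
      requires with \<open>diag3 E a b\<close> as \<open>F\<close> and \<open>diag3 L a b\<close> as
      \<open>G\<close>.\<close>
    have "(diag3 (E * L) a b)\<^sup>T = diag3 (E * L) a b" unfolding transpose_diag3 E_L_sym ..
    then have "\<exists>\<rho>. neg_def (\<Omega>' ?Z + \<rho> \<cdot>\<^sub>m (1\<^sub>m (m + a + b) - diag3 E a b * diag3 L a b))"
      using finsler[OF \<Omega>'_carrier[OF Z] sym d3(3,4) LE] neg brl[of 0] unfolding EL \<Omega>0 by simp
    then obtain \<rho> where \<rho>: "neg_def (\<Omega>' ?Z + \<rho> \<cdot>\<^sub>m (1\<^sub>m (m + a + b) - diag3 (E * L) a b))" unfolding EL by blast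
    have "E * L \<in> carrier_mat m m" using mult_carrier_mat[OF E L] .
    moreover have "1\<^sub>m m - E * L = M_mat E" unfolding M_mat_def using E by simp
    ultimately have "\<Omega>' ?Z + \<rho> \<cdot>\<^sub>m (1\<^sub>m (m + a + b) - diag3 (E * L) a b) = \<Omega> \<rho>"
      unfolding \<Omega>'0 unfolding \<Omega>_def \<Omega>'_def
      by (simp only: one_minus_diag3 nine_block_mat_add_diag[OF Y11 Y(1,2,3) X(1,2) V X(3,4) \<rho>M])
    with \<rho> have "neg_def (\<Omega> \<rho>)" by simp
    then have "neg_def (?G \<rho>)"
      unfolding G[symmetric] \<Omega>_def
      by (intro neg_def_congruence[OF \<Omega>'_carrier[OF \<rho>M] _ d3(1,2) QP(2)])
    then show "\<exists>\<rho>. neg_def (?G \<rho>)" ..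
  qed
qed

section \<open>Sparsity after descent and blockwise inverses\<close>

lemma E_congruence_zero:
  assumes P: "\<And>k. k \<in> {1..q} \<Longrightarrow> P k \<in> carrier_mat (d k) (d k)" and bc: "b < n" "c < n"
    and disj: "clique_idx q Cl (node ns b) \<inter> clique_idx q Cl (node ns c) = {}"
  shows "(E\<^sup>T * blkdiag P * E) $$ (b, c) = 0"
proof -
  have "((Ek k)\<^sup>T * P k * Ek k) $$ (b, c) = 0" if k: "k \<in> {1..q}" for k
  proof -
    from disj k have "\<not> (node ns b \<in> Cl k \<and> node ns c \<in> Cl k)" by (auto simp: clique_idx_def)
    then show ?thesis by (rule E_clique_congruence_zero[OF Cl_nodes[OF k] P[OF k] bc])
  qed
  then have "(\<Sum>k = 1..q. ((Ek k)\<^sup>T * P k * Ek k) $$ (b, c)) = 0" by (intro sum.neutral) blast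
  then show ?thesis using E_congruence[OF P bc] by simp
qed

text \<open>\<open>L\<close> is \<open>E\<^sup>T\<close> with rows divided by the clique counts, so
  the gain inherits the zero pattern of \<open>E\<^sup>T * X * E\<close>.\<close>

lemma L_congruence:
  assumes "X \<in> carrier_mat m m"
  shows "L * X * E = mat_diag n (\<lambda>b. 1 / cnt b) * (E\<^sup>T * X * E)"
proof -
  have "dim_row E = m" "dim_col E = n" using E_carrier by auto
  then show ?thesis unfolding left_inv_def inv_gram using assms
    by (simp add: mat_assoc_dim mat_diag_def)
qed

lemma blkdiag_inverse:
  assumes "\<And>k. k \<in> {1..q} \<Longrightarrow> P k \<in> carrier_mat (d k) (d k) \<and> pos_def (P k)"
  shows "\<exists>R. (\<forall>k\<in>{1..q}. R k \<in> carrier_mat (d k) (d k) \<and> pos_def (R k)) \<and>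
    blkdiag P * blkdiag R = 1\<^sub>m m \<and> blkdiag R * blkdiag P = 1\<^sub>m m"
proof -
  have "\<forall>k\<in>{1..q}. \<exists>Y. Y \<in> carrier_mat (d k) (d k) \<and> P k * Y = 1\<^sub>m (d k) \<and> Y * P k = 1\<^sub>m (d k) \<and> pos_def Y"
    using assms pos_def_inverse by blast
  then obtain R where R: "\<And>k. k \<in> {1..q} \<Longrightarrow> R k \<in> carrier_mat (d k) (d k)" "\<And>k. k \<in> {1..q} \<Longrightarrow> P k * R k = 1\<^sub>m (d k)"
    "\<And>k. k \<in> {1..q} \<Longrightarrow> R k * P k = 1\<^sub>m (d k)" "\<And>k. k \<in> {1..q} \<Longrightarrow> pos_def (R k)"
    by (metis (no_types, lifting))
  have "blkdiag P * blkdiag R = 1\<^sub>m m" "blkdiag R * blkdiag P = 1\<^sub>m m"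
    by (rule trans[OF blkdiag_mult blkdiag_eq_one]; use assms R in blast)+
  with R show ?thesis by blast
qed

end

theorem theorem3:
  fixes N q nw ny :: nat
    and G :: "nat pair_pre_digraph"
    and ns :: "nat \<Rightarrow> nat"
    and Cl :: "nat \<Rightarrow> nat set"
    and A B Bw C D Dw :: "real mat"
    and \<gamma> :: real
  assumes graph: "pair_graph G" "pverts G = {1..N}"
    and dims_pos: "\<And>i. i \<in> {1..N} \<Longrightarrow> 0 < ns i"
    and cliques: "\<And>k. k \<in> {1..q} \<Longrightarrow> clique G (Cl k)"
    and cliques_distinct: "inj_on Cl {1..q}"
    and A: "A \<in> carrier_mat (total_dim N ns) (total_dim N ns)"
    and B: "B \<in> carrier_mat (total_dim N ns) (total_dim N ns)"
    and Bw: "Bw \<in> carrier_mat (total_dim N ns) nw"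
    and C: "C \<in> carrier_mat ny (total_dim N ns)"
    and D: "D \<in> carrier_mat ny (total_dim N ns)"
    and Dw: "Dw \<in> carrier_mat ny nw"
    and nodes_covered: "\<And>i. i \<in> {1..N} \<Longrightarrow> clique_idx q Cl i \<noteq> {}"
    and edges_covered: "\<And>i j. i \<in> {1..N} \<Longrightarrow> j \<in> {1..N} \<Longrightarrow> i \<noteq> j \<Longrightarrow>
      clique_idx q Cl i \<inter> clique_idx q Cl j \<noteq> {} \<longleftrightarrow> (i, j) \<in> parcs G"
  shows "K_hat N ns q Cl A B Bw C D Dw \<gamma> \<subseteq> K_set N ns G A B Bw C D Dw \<gamma> \<and>
    (chordal G \<and> Cl ` {1..q} = {S. maximal_clique G S} \<longrightarrow>
      K_hat N ns q Cl A B Bw C D Dw \<gamma> = K_set N ns G A B Bw C D Dw \<gamma>)"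
proof -
  interpret clique_cover N q ns Cl
    using cliques graph(2) nodes_covered by unfold_locales (auto simp: clique_def)
  interpret pair_graph G by (rule graph(1))
  note lifted_iff = lifted_inequality_iff[OF A B Bw C D Dw]
  have disjoint: "clique_idx q Cl (node ns b) \<inter> clique_idx q Cl (node ns c) = {}"
    if "b < n" "c < n" "node ns b \<noteq> node ns c" "(node ns b, node ns c) \<notin> parcs G" for b c
    using edges_covered[of "node ns b" "node ns c"] node_bounds(1)[OF that(1)] node_bounds(1)[OF that(2)] that(3,4) by blast
  \<comment> \<open>The nodes cannot coincide, since the index set of a single node is
    nonempty.\<close>
  have not_adjacent: "node ns b \<noteq> node ns c \<and> (node ns b, node ns c) \<notin> parcs G"
    if "b < n" "c < n" "clique_idx q Cl (node ns b) \<inter> clique_idx q Cl (node ns c) = {}" for b c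
    using edges_covered[of "node ns b" "node ns c"] nodes_covered[of "node ns b"]
      node_bounds(1)[OF that(1)] node_bounds(1)[OF that(2)] that(3) by (metis inf.idem)
  have sub: "K_hat N ns q Cl A B Bw C D Dw \<gamma> \<subseteq> K_set N ns G A B Bw C D Dw \<gamma>"
  proof
    fix K0 assume "K0 \<in> K_hat N ns q Cl A B Bw C D Dw \<gamma>"
    then obtain Z Q where K0: "K0 = L * (Z * inv_mat Q) * E" and Z: "Z \<in> blkdiags ns q Cl" and Q: "Q \<in> blkdiags_pd ns q Cl"
      and neg: "\<exists>\<rho>. neg_def (Gamma_mat A B Bw C D Dw \<gamma> E Q Z +
             diag_block_mat [\<rho> \<cdot>\<^sub>m (Q * M_mat E * Q), 0\<^sub>m (dim_col Bw) (dim_col Bw), 0\<^sub>m (dim_row C) (dim_row C)])"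
      unfolding K_hat_def Let_def by blast
    from Z obtain Zk where Zk: "Z = blkdiag Zk" "\<And>k. k \<in> {1..q} \<Longrightarrow> Zk k \<in> carrier_mat (d k) (d k)"
      unfolding blkdiags_def by blast
    from Q obtain Qk where Qk: "Q = blkdiag Qk" "\<And>k. k \<in> {1..q} \<Longrightarrow> Qk k \<in> carrier_mat (d k) (d k) \<and> pos_def (Qk k)"
      unfolding blkdiags_pd_def by blast
    obtain R where R: "\<And>k. k \<in> {1..q} \<Longrightarrow> R k \<in> carrier_mat (d k) (d k)" "\<And>k. k \<in> {1..q} \<Longrightarrow> pos_def (R k)"
      and inv: "Q * blkdiag R = 1\<^sub>m m" "blkdiag R * Q = 1\<^sub>m m"
      using blkdiag_inverse[of Qk] Qk by blast
    define P where "P = blkdiag R"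
    have Qc: "Q \<in> carrier_mat m m" unfolding Qk(1) by (rule blkdiag_carrier) (use Qk(2) in blast)
    have Pc: "P \<in> carrier_mat m m" unfolding P_def by (rule blkdiag_carrier[OF R(1)])
    have Zc: "Z \<in> carrier_mat m m" unfolding Zk(1) by (rule blkdiag_carrier[OF Zk(2)])
    have QT: "Q\<^sup>T = Q" using blkdiag_pos_def[of Qk] Qk by (auto simp: pos_def_def)
    have Ppd: "pos_def P" unfolding P_def by (rule blkdiag_pos_def[OF R])
    then have PT: "P\<^sup>T = P" by (simp add: pos_def_def)
    note inv = inv[folded P_def]
    have "inv_mat Q = P" by (rule inv_mat_eqI[OF Qc Pc inv])
    with K0 have K0': "K0 = L * (Z * P) * E" by simp
    have K: "Z * P \<in> carrier_mat m m" using mult_carrier_mat[OF Zc Pc] .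
    have ZPQ: "Z * P * Q = Z" using Zc Pc Qc inv by (simp add: mat_assoc_dim)
    have brl: "neg_def (brl_mat A B Bw C D Dw \<gamma> K0 (E\<^sup>T * P * E))"
      using lifted_iff[OF K Qc QT Pc PT inv] neg unfolding ZPQ K0' by blast
    have ZP: "Z * P = blkdiag (\<lambda>k. Zk k * R k)" unfolding Zk(1) P_def by (rule blkdiag_mult[OF Zk(2) R(1)])
    have K_sparse: "K0 \<in> sparse_mats N ns G"
      unfolding sparse_mats_iff
    proof (intro conjI allI impI)
      show "K0 \<in> carrier_mat n n" unfolding K0' using E_carrier L_carrier K by (intro carrier_matI; simp)
      have EZE: "E\<^sup>T * (Z * P) * E \<in> carrier_mat n n" using E_carrier K by (intro carrier_matI; simp)
      fix b c assume bc: "b < n" "c < n" "node ns b \<noteq> node ns c" "(node ns b, node ns c) \<notin> parcs G"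
      have "(E\<^sup>T * (Z * P) * E) $$ (b, c) = 0"
        unfolding ZP using bc Zk(2) R(1) by (intro E_congruence_zero disjoint mult_carrier_mat)
      then show "K0 $$ (b, c) = 0"
        unfolding K0' L_congruence[OF K] mat_diag_mult_left[OF EZE] using bc by simp
    qed
    have P_sparse: "E\<^sup>T * P * E \<in> sparse_mats N ns G"
      unfolding sparse_mats_iff
    proof (intro conjI allI impI)
      show "E\<^sup>T * P * E \<in> carrier_mat n n" using E_carrier Pc by (intro carrier_matI; simp)
      fix b c assume bc: "b < n" "c < n" "node ns b \<noteq> node ns c" "(node ns b, node ns c) \<notin> parcs G"
      show "(E\<^sup>T * P * E) $$ (b, c) = 0"
        unfolding P_def using bc R(1) by (intro E_congruence_zero disjoint)
    qed
    show "K0 \<in> K_set N ns G A B Bw C D Dw \<gamma>"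
      unfolding K_set_def using K_sparse P_sparse brl pos_def_congruence[OF Pc Ppd E_carrier L_carrier L_E] by blast
  qed
  moreover have "K_set N ns G A B Bw C D Dw \<gamma> \<subseteq> K_hat N ns q Cl A B Bw C D Dw \<gamma>"
    if ch: "chordal G" and max: "Cl ` {1..q} = {S. maximal_clique G S}"
  proof
    fix K0 assume "K0 \<in> K_set N ns G A B Bw C D Dw \<gamma>"
    then obtain P0 where K0: "K0 \<in> sparse_mats N ns G" and P0: "P0 \<in> sparse_mats N ns G" "pos_def P0"
      and neg: "neg_def (brl_mat A B Bw C D Dw \<gamma> K0 P0)"
      unfolding K_set_def by blast
    have K0c: "K0 \<in> carrier_mat n n" and P0c: "P0 \<in> carrier_mat n n" using K0 P0 by (auto simp: sparse_mats_iff)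
    define adj where "adj b c \<longleftrightarrow> node ns b = node ns c \<or> (node ns b, node ns c) \<in> parcs G" for b c
    have elim: "\<exists>a\<in>R. \<exists>k\<in>{1..q}. {b \<in> R. adj a b} \<subseteq> {b. node ns b \<in> Cl k} \<and>
      (\<forall>b\<in>R. \<forall>c\<in>R. adj a b \<longrightarrow> adj a c \<longrightarrow> adj b c)" if R: "R \<subseteq> {..<n}" "R \<noteq> {}" for R
    proof -
      have "finite R" using R(1) finite_subset by blast
      then obtain a where a: "a \<in> R" and simpl: "simplicial (parcs G) (node ns ` R) (node ns a)"
        using chordal_simplicial[OF graph(1) ch, of "node ns ` R"] R(2) by auto
      \<comment> \<open>The closed neighbourhood of the pivot's node among the remaining nodes.
        Simpliciality makes it a clique, and a maximal clique above it is one of the listed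
        ones.\<close>
      define S where "S = {z \<in> node ns ` R. z = node ns a \<or> (node ns a, z) \<in> parcs G}"
      have adjS: "x = y \<or> (x, y) \<in> parcs G" if "x \<in> S" "y \<in> S" for x y
        using that simpl arcs_symmetric by (auto simp: S_def simplicial_def)
      have "clique G S"
        unfolding clique_def graph(2)
      proof (intro conjI ballI impI)
        show "S \<noteq> {}" using a by (auto simp: S_def)
        show "S \<subseteq> {1..N}" using R(1) node_bounds(1) unfolding S_def by blast
      qed (use adjS in blast)
      then obtain T where T: "maximal_clique G T" "S \<subseteq> T"
        using clique_extends_to_maximal[of G S] graph(2) by auto
      then obtain k where k: "k \<in> {1..q}" "Cl k = T" using max by (metis imageE mem_Collect_eq)
      have inS: "node ns b \<in> S" if "b \<in> R" "adj a b" for b using that by (auto simp: S_def adj_def)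
      show ?thesis
      proof (intro bexI conjI ballI impI)
        show "{b \<in> R. adj a b} \<subseteq> {b. node ns b \<in> Cl k}" using inS T k by auto
        show "adj b c" if "b \<in> R" "c \<in> R" "adj a b" "adj a c" for b c
          using adjS[OF inS inS] that by (auto simp: adj_def)
      qed (use a k in auto)
    qed
    have supp: "P0 $$ (b, c) = 0" if "b < n" "c < n" "\<not> adj b c" for b c
      using P0(1) that by (auto simp: sparse_mats_iff adj_def)
    have "\<exists>R. (\<forall>k\<in>{1..q}. R k \<in> carrier_mat (d k) (d k) \<and> pos_def (R k)) \<and> E\<^sup>T * blkdiag R * E = P0"
      by (rule pos_def_lift[OF P0c P0(2) _ supp elim]) (simp_all add: adj_def)
    then obtain R where R: "\<And>k. k \<in> {1..q} \<Longrightarrow> R k \<in> carrier_mat (d k) (d k) \<and> pos_def (R k)"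
      and P0E: "E\<^sup>T * blkdiag R * E = P0"
      by blast
    define P where "P = blkdiag R"
    obtain Qk where Qk: "\<And>k. k \<in> {1..q} \<Longrightarrow> Qk k \<in> carrier_mat (d k) (d k) \<and> pos_def (Qk k)"
      and inv: "P * blkdiag Qk = 1\<^sub>m m" "blkdiag Qk * P = 1\<^sub>m m"
      using blkdiag_inverse[OF R] unfolding P_def by blast
    define Q where "Q = blkdiag Qk"
    note inv = inv[folded Q_def]
    have Pc: "P \<in> carrier_mat m m" unfolding P_def by (rule blkdiag_carrier) (use R in blast)
    have Qc: "Q \<in> carrier_mat m m" unfolding Q_def by (rule blkdiag_carrier) (use Qk in blast)
    have PT: "P\<^sup>T = P" using blkdiag_pos_def[of R] R by (auto simp: pos_def_def P_def)
    have QT: "Q\<^sup>T = Q" using blkdiag_pos_def[of Qk] Qk by (auto simp: pos_def_def Q_def)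
    \<comment> \<open>\<open>L\<close> divides by the clique counts, so the matrix to be lifted is
      \<open>K0\<close> with its rows multiplied by them.\<close>
    have DK: "mat_diag n cnt * K0 \<in> carrier_mat n n" by (rule mult_carrier_mat[OF mat_diag_dim K0c])
    have "(mat_diag n cnt * K0) $$ (b, c) = 0"
      if "b < n" "c < n" "clique_idx q Cl (node ns b) \<inter> clique_idx q Cl (node ns c) = {}" for b c
      using K0 not_adjacent[OF that] that(1,2) unfolding mat_diag_mult_left[OF K0c] by (simp add: sparse_mats_iff)
    then obtain Kk where Kk: "\<And>k. k \<in> {1..q} \<Longrightarrow> Kk k \<in> carrier_mat (d k) (d k)"
      and KE: "E\<^sup>T * blkdiag Kk * E = mat_diag n cnt * K0"
      using sparse_lift[OF DK] by blast
    define K where "K = blkdiag Kk"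
    have K: "K \<in> carrier_mat m m" unfolding K_def by (rule blkdiag_carrier[OF Kk])
    have "L * K * E = mat_diag n (\<lambda>b. 1 / cnt b) * (mat_diag n cnt * K0)"
      unfolding L_congruence[OF K] unfolding K_def KE ..
    also have "\<dots> = mat_diag n (\<lambda>b. 1 / cnt b * cnt b) * K0"
      unfolding assoc_mult_mat[OF mat_diag_dim mat_diag_dim K0c, symmetric] mat_diag_diag ..
    also have "\<dots> = K0"
      unfolding mat_diag_mult_left[OF K0c] using K0c by (intro eq_matI) (auto simp: cnt_nonzero)
    finally have LKE: "L * K * E = K0" .
    have KQP: "K * Q * P = K" using K Pc Qc inv by (simp add: mat_assoc_dim)
    have iQ: "inv_mat Q = P" by (rule inv_mat_eqI[OF Qc Pc inv(2,1)])
    have "\<exists>\<rho>. neg_def (Gamma_mat A B Bw C D Dw \<gamma> E Q (K * Q) +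
        diag_block_mat [\<rho> \<cdot>\<^sub>m (Q * M_mat E * Q), 0\<^sub>m (dim_col Bw) (dim_col Bw), 0\<^sub>m (dim_row C) (dim_row C)])"
      unfolding lifted_iff[OF K Qc QT Pc PT inv(2,1)] LKE using neg P0E by (simp add: P_def)
    moreover have "K * Q \<in> blkdiags ns q Cl"
    proof -
      have "K * Q = blkdiag (\<lambda>k. Kk k * Qk k)" unfolding K_def Q_def by (rule blkdiag_mult) (use Kk Qk in blast)+
      moreover have "\<forall>k\<in>{1..q}. Kk k * Qk k \<in> carrier_mat (d k) (d k)" using Kk Qk mult_carrier_mat by blast
      ultimately show ?thesis unfolding blkdiags_def by blast
    qed
    moreover have "Q \<in> blkdiags_pd ns q Cl" unfolding blkdiags_pd_def Q_def using Qk by blast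
    moreover have "K0 = L * (K * Q * inv_mat Q) * E" unfolding iQ KQP LKE ..
    ultimately show "K0 \<in> K_hat N ns q Cl A B Bw C D Dw \<gamma>" unfolding K_hat_def Let_def by blast
  qed
  ultimately show ?thesis by blast
qed

end
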